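(* Let $A,B,C,D\in\widehat{\mathbb{F}_q^{*}}$. Then $$ {}_{4}F_3\!\left(\begin{array}{cccc} A, & B, & C, & D\\ & A\bar{B}, & A\bar{C}, & A\bar{D}\end{array}\Big|\;-1\right)_q^{\star}=0 \quad\text{if } A \text{ is not a square}, $$ and if $A$ is a square with $A\neq\varepsilon$, $B\neq\varepsilon$, $B^2\neq A$ and $CD\neq A$, then $$ {}_{4}F_3\!\left(\begin{array}{cccc} A, & B, & C, & D\\ & A\bar{B}, & A\bar{C}, & A\bar{D}\end{array}\Big|\;-1\right)_q^{\star} =\frac{g(\bar{A})\,g(\bar{A}CD)}{g(\bar{A}C)\,g(\bar{A}D)}\sum_{R^2=A}{}_{3}F_2\!\left(\begin{array}{ccc} R\bar{B}, & C, & D\\ & R, & A\bar{B}\end{array}\Big|\;1\right)_q^{\star}. $$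
   Context: Let $q$ be a prime power and $\mathbb{F}_q$ the finite field with $q$ elements. $\widehat{\mathbb{F}_q^{*}}$ denotes the group of multiplicative characters of $\mathbb{F}_q^{*}$; every character $\chi$ (including the trivial character $\varepsilon$) is extended to $\mathbb{F}_q$ by $\chi(0):=0$. $\bar{\chi}$ denotes the inverse character, and juxtaposition denotes pointwise product of characters (e.g. $\bar{A}CD=A^{-1}CD$, $\overline{B\chi}=(B\chi)^{-1}$). Fix a non-trivial additive character $\theta$ of $\mathbb{F}_q$ and define the Gauss sum $g(\chi):=\sum_{x\in\mathbb{F}_q}\chi(x)\theta(x)$. For $A_0,\dots,A_n,B_1,\dots,B_n\in\widehat{\mathbb{F}_q^{*}}$ and $x\in\mathbb{F}_q$ define $$ {}_{n+1}F_n\!\left(\begin{array}{cccc} A_0, & A_1, & \dots, & A_n\\ & B_1, & \dots, & B_n\end{array}\Big|\;x\right)_q^{\star}:=\frac{1}{q-1}\sum_{\chi\in\widehat{\mathbb{F}_q^{*}}}\prod_{i=0}^{n}\frac{g(A_i\chi)}{g(A_i)}\prod_{j=1}^{n}\frac{g(\overline{B_j\chi})}{g(\overline{B_j})}\,g(\bar{\chi})\,\chi(-1)^{n+1}\chi(x). $$ "$A$ is a square" means $A=S^2$ for some $S\in\widehat{\mathbb{F}_q^{*}}$, and $\sum_{R^2=A}$ denotes the sum over all characters $R\in\widehat{\mathbb{F}_q^{*}}$ with $R^2=A$.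
   Formalization: The second formula (for A a square) is stated and proved only for odd q, since it is false for even q: for q=4, ψ a cubic character, A=B=C=ψ, D=ψ², the left side is 0 and the right side is 2; the vanishing claim is for all q. *)

theory Defs
  imports
    Complex_Main
    "HOL-Library.Cardinality"
    "HOL-Library.Function_Division"
    "HOL-Computational_Algebra.Primes"
begin

text \<open>
  The field \<open>F\<^sub>q\<close> is a type \<open>'a\<close> of class \<open>finite_field\<close> with \<open>q = CARD('a)\<close>.
  A homomorphism \<open>F\<^sub>q\<^sup>* \<rightarrow> \<complex>\<^sup>*\<close> is represented by its extension by \<open>0\<close> at \<open>0\<close>, a
  function on \<open>'a\<close>. Products, powers and inverses of characters are then the pointwise
  operations on functions; since \<open>inverse 0 = 0\<close> they respect the convention at \<open>0\<close>.
  The function \<open>1\<close> is not a character: the trivial character is \<open>triv_char\<close>.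
\<close>

definition mult_chars :: "('a :: finite_field \<Rightarrow> complex) set" where
  "mult_chars = {\<chi>. (\<forall>x. \<chi> x = 0 \<longleftrightarrow> x = 0) \<and> (\<forall>x y. \<chi> (x * y) = \<chi> x * \<chi> y)}"

definition triv_char :: "'a :: finite_field \<Rightarrow> complex" where
  "triv_char x = (if x = 0 then 0 else 1)"

definition additive_char :: "('a :: finite_field \<Rightarrow> complex) \<Rightarrow> bool" where
  "additive_char \<theta> \<longleftrightarrow> (\<forall>x. \<theta> x \<noteq> 0) \<and> (\<forall>x y. \<theta> (x + y) = \<theta> x * \<theta> y)"

definition nontrivial_additive_char :: "('a :: finite_field \<Rightarrow> complex) \<Rightarrow> bool" where
  "nontrivial_additive_char \<theta> \<longleftrightarrow> additive_char \<theta> \<and> (\<exists>x. \<theta> x \<noteq> 1)"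

definition gauss_sum ::
    "('a :: finite_field \<Rightarrow> complex) \<Rightarrow> ('a \<Rightarrow> complex) \<Rightarrow> complex" where
  "gauss_sum \<theta> \<chi> = (\<Sum>x\<in>UNIV. \<chi> x * \<theta> x)"

text \<open>
  \<open>hyp_star \<theta> [A\<^sub>0, \<dots>, A\<^sub>n] [B\<^sub>1, \<dots>, B\<^sub>n] x\<close> is the function \<open>\<^sub>n\<^sub>+\<^sub>1F\<^sub>n\<close>; it is meant for
  \<open>length As = length Bs + 1\<close>.
\<close>

definition hyp_star ::
    "('a :: finite_field \<Rightarrow> complex) \<Rightarrow> ('a \<Rightarrow> complex) list \<Rightarrow> ('a \<Rightarrow> complex) list \<Rightarrow> 'a \<Rightarrow> complex"
  where
  "hyp_star \<theta> As Bs x =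
     1 / (of_nat CARD('a) - 1) *
     (\<Sum>\<chi>\<in>mult_chars.
        (\<Prod>A\<leftarrow>As. gauss_sum \<theta> (A * \<chi>) / gauss_sum \<theta> A) *
        (\<Prod>B\<leftarrow>Bs. gauss_sum \<theta> (inverse (B * \<chi>)) / gauss_sum \<theta> (inverse B)) *
        gauss_sum \<theta> (inverse \<chi>) * \<chi> (-1) ^ (length Bs + 1) * \<chi> x)"

lemma triv_char_in_mult_chars: "triv_char \<in> mult_chars"
  by (auto simp: mult_chars_def triv_char_def)

lemma mult_in_mult_chars:
  "\<chi> \<in> mult_chars \<Longrightarrow> \<psi> \<in> mult_chars \<Longrightarrow> \<chi> * \<psi> \<in> mult_chars"
  by (auto simp: mult_chars_def times_fun_def)

lemma inverse_in_mult_chars: "\<chi> \<in> mult_chars \<Longrightarrow> inverse \<chi> \<in> mult_chars"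
  by (auto simp: mult_chars_def)

lemma mult_inverse_char: "\<chi> \<in> mult_chars \<Longrightarrow> \<chi> * inverse \<chi> = triv_char"
  by (auto simp: mult_chars_def triv_char_def times_fun_def fun_eq_iff)

lemma finite_mult_chars: "finite (mult_chars :: ('a :: finite_field \<Rightarrow> complex) set)"
proof -
  let ?q = "CARD('a)"
  have "(mult_chars :: ('a \<Rightarrow> complex) set) \<subseteq> {f. \<forall>x. f x \<in> {z. z ^ ?q = z}}"
  proof safe
    fix \<chi> :: "'a \<Rightarrow> complex" and x :: 'a
    assume \<chi>: "\<chi> \<in> mult_chars"
    have "\<chi> (1 * 1) = \<chi> 1 * \<chi> 1" "\<chi> 1 \<noteq> 0"
      using \<chi> unfolding mult_chars_def by (blast, simp)
    then have one: "\<chi> 1 = 1" by simp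
    have "\<chi> (x ^ n) = \<chi> x ^ n" for n
      by (induction n) (use \<chi> one in \<open>auto simp: mult_chars_def\<close>)
    then show "\<chi> x ^ ?q = \<chi> x"
      by (metis finite_field_power_card_eq_same)
  qed
  moreover have "finite {z :: complex. z ^ ?q = z}"
  proof -
    have q: "?q > 1"
      using card_mono[of "UNIV :: 'a set" "{0, 1}"] by simp
    have "{z :: complex. z ^ ?q = z} \<subseteq> insert 0 {z. z ^ (?q - 1) = 1}"
    proof
      fix z :: complex assume z: "z \<in> {z. z ^ ?q = z}"
      have "z ^ ?q = z * z ^ (?q - 1)" using q by (simp flip: power_Suc)
      with z show "z \<in> insert 0 {z. z ^ (?q - 1) = 1}" by auto
    qed
    moreover have "finite {z :: complex. z ^ (?q - 1) = 1}"
      using q by (intro finite_roots_unity) auto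
    ultimately show ?thesis by (meson finite_insert finite_subset)
  qed
  then have "finite {f :: 'a \<Rightarrow> complex. \<forall>x. f x \<in> {z. z ^ ?q = z}}"
    using finite_set_of_finite_funs[of "UNIV :: 'a set" "{z :: complex. z ^ ?q = z}" undefined]
    by simp
  ultimately show ?thesis by (rule finite_subset)
qed

end

theory Submission
  imports Defs "HOL-Algebra.Algebraic_Closure_Type"
begin

text \<open>
  Write \<open>g\<close> for the Gauss sum and \<open>q\<close> for the order of the field. The summand of the well-poised
  series is invariant under \<open>\<chi> \<mapsto> (A\<chi>)\<^sup>-\<^sup>1\<close> up to the factor \<open>A(-1)\<close>, and \<open>A(-1) = -1\<close> if \<open>A\<close> is not a
  square; this gives the vanishing. For the transformation, Barnes' first lemma writes
  \<open>g(C\<chi>) g(A\<^sup>-\<^sup>1C\<chi>\<^sup>-\<^sup>1) g(D\<chi>) g(A\<^sup>-\<^sup>1D\<chi>\<^sup>-\<^sup>1)\<close> as a sum over \<open>\<psi>\<close> of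
  \<open>g(C\<psi>) g(D\<psi>) g(\<chi>\<psi>\<^sup>-\<^sup>1) g(A\<^sup>-\<^sup>1\<chi>\<^sup>-\<^sup>1\<psi>\<^sup>-\<^sup>1)\<close>, here \<open>CD \<noteq> A\<close> is needed. The sum over \<open>\<chi>\<close> then becomes a
  well-poised \<open>\<^sub>3F\<^sub>2(1)\<close>, which is evaluated by Dixon's summation; Dixon's summation in turn reduces to
  Kummer's by the same use of Barnes' lemma. The square roots \<open>R\<close> of \<open>A\<close> enter in Kummer's summation
  through the identity \<open>\<Sum>\<^bsub>R\<^sup>2 = A\<^esub> R(t) = \<Sum>\<^bsub>s\<^sup>2 = t\<^esub> A(s)\<close>.
\<close>

section \<open>Cyclicity of the unit group and separation of points by characters\<close>

lemma finite_field_generator: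
  "\<exists>w :: 'a :: finite_field. w \<noteq> 0 \<and> (\<forall>x. x \<noteq> 0 \<longrightarrow> (\<exists>i. x = w ^ i))"
proof -
  \<comment> \<open>The type is viewed as a ring with carrier, for which the unit group of a finite
    field is known to be cyclic; \<open>K_simps\<close> and \<open>pow\<close> carry the generator
    back.\<close>
  define K where "K = (ring_of_type_algebra :: 'a ring)"
  interpret K: field K unfolding K_def by rule
  have K_simps: "carrier K = UNIV" "\<zero>\<^bsub>K\<^esub> = 0" "\<one>\<^bsub>K\<^esub> = 1" "x \<otimes>\<^bsub>K\<^esub> y = x * y" for x y
    by (simp_all add: K_def ring_of_type_algebra_def)
  have pow: "x [^]\<^bsub>K\<^esub> i = x ^ i" for x and i :: nat
    by (induction i) (simp_all add: K_simps mult.commute)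
  obtain w where "w \<in> carrier (mult_of K)"
      "carrier (mult_of K) = {w [^]\<^bsub>K\<^esub> i | i :: nat. i \<in> UNIV}"
    using K.finite_field_mult_group_has_gen by (auto simp: K_simps)
  then have "w \<noteq> 0" and "- {0} = {w ^ i | i. True}"
    by (auto simp: K_simps pow)
  then show ?thesis by blast
qed

lemma card_field_gt_1: "CARD('a :: finite_field) > 1"
  using card_mono[of "UNIV :: 'a set" "{0, 1}"] by simp

text \<open>Sending a generator \<open>w\<close> to a primitive root of unity \<open>z\<close> of
  the same order n = q - 1 gives a faithful character, so it separates any
  \<open>t \<noteq> 1\<close> from 1.\<close>

lemma exists_separating_char:
  fixes t :: "'a :: finite_field"
  assumes "t \<noteq> 0" "t \<noteq> 1"
  shows "\<exists>\<chi>\<in>mult_chars. \<chi> t \<noteq> 1"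
proof -
  obtain w :: 'a where w: "w \<noteq> 0" and gen: "\<And>x. x \<noteq> 0 \<Longrightarrow> \<exists>i. x = w ^ i"
    using finite_field_generator by blast
  define n where "n = CARD('a) - 1"
  have n: "n > 0" using card_field_gt_1[where 'a = 'a] by (simp add: n_def)
  have wn: "w ^ n = 1"
  proof -
    have "w * w ^ n = w" using n finite_field_power_card_eq_same[of w]
      by (simp add: n_def flip: power_Suc)
    then show ?thesis using w by simp
  qed
  have pow_mod: "w ^ i = w ^ (i mod n)" for i
    by (metis div_mult_mod_eq mult.commute mult_1 power_add power_mult power_one wn)
  \<comment> \<open>The n powers of \<open>w\<close> cover all n nonzero elements, so by counting no
    two of them coincide.\<close>
  have inj: "inj_on (\<lambda>i. w ^ i) {..<n}"
  proof (rule eq_card_imp_inj_on)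
    have "(\<lambda>i. w ^ i) ` {..<n} = - {0}"
    proof (intro equalityI subsetI)
      fix x assume "x \<in> - {0 :: 'a}"
      then obtain i where "x = w ^ i" using gen by auto
      then show "x \<in> (\<lambda>i. w ^ i) ` {..<n}" using pow_mod[of i] n by auto
    qed (use w in auto)
    then show "card ((\<lambda>i. w ^ i) ` {..<n}) = card {..<n}"
      by (simp add: n_def Compl_eq_Diff_UNIV)
  qed simp
  have mod_eq: "i mod n = j mod n" if "w ^ i = w ^ j" for i j
    using that inj_onD[OF inj, of "i mod n" "j mod n"] n pow_mod by simp
  define z where "z = cis (2 * pi / n)"
  have zn: "z ^ n = 1" using n by (simp add: z_def DeMoivre)
  have z_mod: "z ^ i = z ^ (i mod n)" for i
    by (metis div_mult_mod_eq mult.commute mult_1 power_add power_mult power_one zn)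
  define lg where "lg x = (SOME i. x = w ^ i)" for x
  have lg: "w ^ lg x = x" if "x \<noteq> 0" for x
    using someI_ex[OF gen[OF that]] by (simp add: lg_def)
  define \<chi> where "\<chi> x = (if x = 0 then 0 else z ^ lg x)" for x
  \<comment> \<open>\<open>lg\<close> picks an arbitrary exponent, but exponents of the same element
    agree mod n and \<open>z ^ n = 1\<close>, so the choice does not affect
    \<open>\<chi>\<close>.\<close>
  have z_lg: "z ^ lg (w ^ i) = z ^ i" for i
    using mod_eq[of "lg (w ^ i)" i] lg[of "w ^ i"] w z_mod by (metis power_not_zero)
  have "\<chi> (x * y) = \<chi> x * \<chi> y" for x y
  proof (cases "x = 0 \<or> y = 0")
    case False
    then have "x * y = w ^ (lg x + lg y)" by (simp add: power_add lg)
    then have "z ^ lg (x * y) = z ^ lg x * z ^ lg y"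
      using z_lg[of "lg x + lg y"] by (simp add: power_add)
    then show ?thesis using False by (simp add: \<chi>_def)
  qed (auto simp: \<chi>_def)
  then have "\<chi> \<in> mult_chars"
    by (auto simp: mult_chars_def \<chi>_def z_def)
  moreover have "\<chi> t \<noteq> 1"
  proof
    assume "\<chi> t = 1"
    then have "z ^ (lg t mod n) = 1" using assms z_mod by (simp add: \<chi>_def)
    then have "cis (2 * pi * real (lg t mod n) / real n) = cis (2 * pi * real 0 / real n)"
      by (simp add: z_def DeMoivre mult_ac)
    moreover have "inj_on (\<lambda>k. cis (2 * pi * real k / real n)) {..<n}"
      using bij_betw_roots_unity[OF n] by (simp add: bij_betw_def)
    ultimately have "lg t mod n = 0"
      using n by (auto dest: inj_onD[of _ _ "lg t mod n" 0])
    then have "w ^ lg t = 1" using pow_mod[of "lg t"] by simp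
    then show False using lg assms by simp
  qed
  ultimately show ?thesis by blast
qed

section \<open>Multiplicative characters\<close>

lemma char_0: "\<chi> \<in> mult_chars \<Longrightarrow> \<chi> 0 = 0"
  and char_eq_0_iff: "\<chi> \<in> mult_chars \<Longrightarrow> \<chi> x = 0 \<longleftrightarrow> x = 0"
  and char_mult: "\<chi> \<in> mult_chars \<Longrightarrow> \<chi> (x * y) = \<chi> x * \<chi> y"
  by (auto simp: mult_chars_def)

lemma char_1: "\<chi> \<in> mult_chars \<Longrightarrow> \<chi> 1 = 1"
  using char_mult[of \<chi> 1 1] char_eq_0_iff[of \<chi> 1] by simp

lemma char_inverse: "\<chi> \<in> mult_chars \<Longrightarrow> \<chi> (inverse x) = inverse (\<chi> x)"
  using char_mult[of \<chi> x "inverse x"] char_1[of \<chi>] char_0[of \<chi>]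
  by (cases "x = 0") (auto simp: inverse_unique)

lemma char_minus_one_mult_self: "\<chi> \<in> mult_chars \<Longrightarrow> \<chi> (-1) * \<chi> (-1) = 1"
  using char_mult[of \<chi> "-1" "-1"] char_1[of \<chi>] by simp

lemma char_minus_one_cancel: "\<chi> \<in> mult_chars \<Longrightarrow> \<chi> (-1) * (\<chi> (-1) * z) = z"
  using char_minus_one_mult_self[of \<chi>] by (simp flip: mult.assoc)

lemma inverse_char_minus_one: "\<chi> \<in> mult_chars \<Longrightarrow> inverse (\<chi> (-1)) = \<chi> (-1)"
  using char_minus_one_mult_self by (metis inverse_unique)

lemma char_minus: "\<chi> \<in> mult_chars \<Longrightarrow> \<chi> (- x) = \<chi> (-1) * \<chi> x"
  using char_mult[of \<chi> "-1" x] by simp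

lemma inverse_char_mult: "inverse (\<chi> * \<psi>) = inverse \<chi> * inverse (\<psi> :: 'a \<Rightarrow> complex)"
  and inverse_inverse_char: "inverse (inverse \<chi>) = (\<chi> :: 'a \<Rightarrow> complex)"
  by (simp_all add: fun_eq_iff)

lemma inverse_triv_char: "inverse triv_char = triv_char"
  by (simp add: fun_eq_iff triv_char_def)

lemma mult_triv_char: "\<chi> \<in> mult_chars \<Longrightarrow> \<chi> * triv_char = \<chi>"
  and triv_char_mult: "\<chi> \<in> mult_chars \<Longrightarrow> triv_char * \<chi> = \<chi>"
  by (auto simp: fun_eq_iff triv_char_def char_0)

lemma char_cancel:
  "\<chi> \<in> mult_chars \<Longrightarrow> \<psi> \<in> mult_chars \<Longrightarrow> \<chi> * (inverse \<chi> * \<psi>) = \<psi>"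
  "\<chi> \<in> mult_chars \<Longrightarrow> \<psi> \<in> mult_chars \<Longrightarrow> inverse \<chi> * (\<chi> * \<psi>) = \<psi>"
proof -
  assume \<chi>: "\<chi> \<in> mult_chars" and \<psi>: "\<psi> \<in> mult_chars"
  have "\<chi> x * (inverse (\<chi> x) * \<psi> x) = \<psi> x" for x
    using \<chi> \<psi> by (cases "x = 0") (simp_all add: char_0 char_eq_0_iff)
  then show "\<chi> * (inverse \<chi> * \<psi>) = \<psi>" "inverse \<chi> * (\<chi> * \<psi>) = \<psi>"
    by (simp_all add: fun_eq_iff mult.left_commute)
qed

lemmas char_intros =
  triv_char_in_mult_chars mult_in_mult_chars inverse_in_mult_chars

lemma char_eqI:
  assumes "\<chi> \<in> mult_chars" "\<psi> \<in> mult_chars" "\<And>x. x \<noteq> 0 \<Longrightarrow> \<chi> x = \<psi> x"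
  shows "\<chi> = \<psi>"
proof
  fix x show "\<chi> x = \<psi> x" using assms by (cases "x = 0") (simp_all add: char_0)
qed

lemma mult_inverse_eq_triv_char_iff:
  assumes "\<chi> \<in> mult_chars" "\<psi> \<in> mult_chars"
  shows "\<chi> * inverse \<psi> = triv_char \<longleftrightarrow> \<chi> = \<psi>"
proof
  assume "\<chi> * inverse \<psi> = triv_char"
  then have "\<psi> * (inverse \<psi> * \<chi>) = \<psi> * triv_char" by (simp add: mult.commute)
  then show "\<chi> = \<psi>" using assms by (simp add: char_cancel mult_triv_char)
qed (use assms in \<open>simp add: mult_inverse_char\<close>)

lemma square_root_char_nontriv:
  assumes "A \<noteq> triv_char" "R\<^sup>2 = A"
  shows "R \<noteq> triv_char"
  using assms mult_triv_char[OF triv_char_in_mult_chars] by (auto simp: power2_eq_square)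

section \<open>Orthogonality relations and the Parseval identity\<close>

lemma sum_char:
  fixes \<chi> :: "'a :: finite_field \<Rightarrow> complex"
  assumes "\<chi> \<in> mult_chars"
  shows "(\<Sum>x\<in>UNIV. \<chi> x) = (if \<chi> = triv_char then of_nat CARD('a) - 1 else 0)"
proof (cases "\<chi> = triv_char")
  case True
  have "(\<Sum>x\<in>UNIV. triv_char (x :: 'a)) = (\<Sum>x\<in>UNIV - {0 :: 'a}. 1)"
    by (rule sum.mono_neutral_cong_right) (auto simp: triv_char_def)
  also have "\<dots> = of_nat CARD('a) - 1"
    using card_field_gt_1[where 'a = 'a] by (simp add: of_nat_diff)
  finally show ?thesis using True by simp
next
  case False
  then obtain y where y: "\<chi> y \<noteq> 1" "y \<noteq> 0"
    using assms by (auto simp: fun_eq_iff triv_char_def char_0 split: if_splits)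
  have "(\<Sum>x\<in>UNIV. \<chi> x) = (\<Sum>x\<in>UNIV. \<chi> (y * x))"
    by (rule sum.reindex_bij_witness[of _ "\<lambda>x. y * x" "\<lambda>x. x / y"]) (use y in auto)
  also have "\<dots> = \<chi> y * (\<Sum>x\<in>UNIV. \<chi> x)"
    using assms by (simp add: char_mult sum_distrib_left)
  finally show ?thesis using y False by (simp add: field_simps)
qed

text \<open>Dual to the shift argument in \<open>sum_char\<close>: translating the summation by a
  character \<open>\<psi>\<close> with \<open>\<psi> t \<noteq> 1\<close> multiplies the sum by
  \<open>\<psi> t\<close>.\<close>

lemma sum_over_chars_eq_0:
  fixes t :: "'a :: finite_field"
  assumes "t \<noteq> 1"
  shows "(\<Sum>\<chi>\<in>mult_chars. \<chi> t) = 0"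
proof (cases "t = 0")
  case False
  then obtain \<psi> where \<psi>: "\<psi> \<in> mult_chars" "\<psi> t \<noteq> 1"
    using exists_separating_char assms by blast
  have "(\<Sum>\<chi>\<in>mult_chars. \<chi> t) = (\<Sum>\<chi>\<in>mult_chars. (\<psi> * \<chi>) t)"
    by (rule sum.reindex_bij_witness[of _ "\<lambda>\<chi>. \<psi> * \<chi>" "\<lambda>\<chi>. inverse \<psi> * \<chi>"])
       (use \<psi> in \<open>auto simp: char_cancel char_intros\<close>)
  also have "\<dots> = \<psi> t * (\<Sum>\<chi>\<in>mult_chars. \<chi> t)"
    by (simp add: sum_distrib_left)
  finally show ?thesis using \<psi> by (simp add: field_simps)
qed (simp add: char_0)

text \<open>For t = 1 this counts the characters. Summing \<open>\<chi> t\<close> over all pairs,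
  only t = 1 survives when \<open>\<chi>\<close> is summed first and only the trivial character when
  t is summed first.\<close>

lemma sum_over_chars:
  fixes t :: "'a :: finite_field"
  shows "(\<Sum>\<chi>\<in>mult_chars. \<chi> t) = (if t = 1 then of_nat CARD('a) - 1 else 0)"
proof (cases "t = 1")
  case True
  have "(\<Sum>\<chi>\<in>mult_chars. \<chi> (1 :: 'a)) =
      (\<Sum>t\<in>(UNIV :: 'a set). if t = 1 then \<Sum>\<chi>\<in>mult_chars. \<chi> (1 :: 'a) else 0)"
    by simp
  also have "\<dots> = (\<Sum>t\<in>UNIV. \<Sum>\<chi>\<in>mult_chars. \<chi> (t :: 'a))"
    by (rule sum.cong) (auto simp: sum_over_chars_eq_0)
  also have "\<dots> = (\<Sum>\<chi>\<in>mult_chars. \<Sum>t\<in>UNIV. \<chi> (t :: 'a))"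
    by (rule sum.swap)
  also have "\<dots> = (\<Sum>\<chi>\<in>mult_chars.
      if \<chi> = (triv_char :: 'a \<Rightarrow> complex) then of_nat CARD('a) - 1 else 0)"
    by (rule sum.cong) (auto simp: sum_char)
  also have "\<dots> = of_nat CARD('a) - 1"
    by (simp add: finite_mult_chars triv_char_in_mult_chars)
  finally show ?thesis using True by simp
qed (simp add: sum_over_chars_eq_0)

text \<open>Orthogonality twice: the sum over s of A(s) R(s)^(-2) detects R^2 = A, and after
  exchanging sums the sum over R of R(t s^(-2)) detects s^2 = t.\<close>

lemma sum_char_square_roots:
  fixes A :: "'a :: finite_field \<Rightarrow> complex"
  assumes A: "A \<in> mult_chars"
  shows "(\<Sum>R\<in>{R \<in> mult_chars. R\<^sup>2 = A}. R t) = (\<Sum>s\<in>{s. s\<^sup>2 = t}. A s)"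
proof (cases "t = 0")
  case False
  let ?q1 = "of_nat CARD('a) - 1 :: complex"
  have q1: "?q1 \<noteq> 0" using card_field_gt_1[where 'a = 'a] by simp
  have *: "?q1 * (if R\<^sup>2 = A then 1 else 0) = (\<Sum>s\<in>UNIV. A s * inverse ((R s)\<^sup>2))"
    if R: "R \<in> mult_chars" for R
  proof -
    have "(\<Sum>s\<in>UNIV. A s * inverse ((R s)\<^sup>2)) = (\<Sum>s\<in>UNIV. (A * inverse (R * R)) s)"
      by (simp add: power2_eq_square)
    also have "\<dots> = ?q1 * (if R\<^sup>2 = A then 1 else 0)"
      using A R by (subst sum_char)
        (auto simp: char_intros mult_inverse_eq_triv_char_iff power2_eq_square)
    finally show ?thesis by simp
  qed
  have "?q1 * (\<Sum>R\<in>{R \<in> mult_chars. R\<^sup>2 = A}. R t) =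
      (\<Sum>R\<in>mult_chars. R t * (?q1 * (if R\<^sup>2 = A then 1 else 0)))"
    by (simp add: sum_distrib_left finite_mult_chars mult_ac if_distrib cong: if_cong
      flip: sum.inter_filter)
  also have "\<dots> = (\<Sum>R\<in>mult_chars. \<Sum>s\<in>UNIV. A s * R (t * inverse (s\<^sup>2)))"
    unfolding sum_distrib_left
    by (intro sum.cong refl, subst *)
      (auto simp: sum_distrib_left char_mult char_inverse power2_eq_square mult_ac)
  also have "\<dots> = (\<Sum>s\<in>UNIV. A s * (\<Sum>R\<in>mult_chars. R (t * inverse (s\<^sup>2))))"
    by (subst sum.swap) (simp add: sum_distrib_left)
  also have "\<dots> = (\<Sum>s\<in>UNIV. if s\<^sup>2 = t then ?q1 * A s else 0)"
    using False
    by (intro sum.cong) (auto simp: sum_over_chars field_simps)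
  also have "\<dots> = ?q1 * (\<Sum>s\<in>{s. s\<^sup>2 = t}. A s)"
    by (simp add: sum_distrib_left flip: sum.inter_filter)
  finally show ?thesis using q1 by simp
qed (use A in \<open>simp add: char_0\<close>)

text \<open>After expanding, the sum over \<open>\<psi>\<close> forces \<open>e * s * t = 1\<close>.
  The term s = 0, where \<open>inverse (e * s)\<close> is the default 0, is harmless because
  \<open>f 0 = 0\<close>.\<close>

lemma parseval_chars:
  fixes f h :: "'a :: finite_field \<Rightarrow> complex"
  assumes e: "e \<noteq> 0" and f: "f 0 = 0"
  shows "(\<Sum>\<psi>\<in>mult_chars. \<psi> e * ((\<Sum>s\<in>UNIV. f s * \<psi> s) * (\<Sum>t\<in>UNIV. h t * \<psi> t))) =
    (of_nat CARD('a) - 1) * (\<Sum>s\<in>UNIV. f s * h (inverse (e * s)))"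
proof -
  let ?q1 = "of_nat CARD('a) - 1 :: complex"
  have "(\<Sum>\<psi>\<in>mult_chars. \<psi> e * ((\<Sum>s\<in>UNIV. f s * \<psi> s) * (\<Sum>t\<in>UNIV. h t * \<psi> t))) =
      (\<Sum>\<psi>\<in>mult_chars. \<Sum>s\<in>UNIV. \<Sum>t\<in>UNIV. f s * h t * \<psi> (e * s * t))"
    by (intro sum.cong refl, subst sum_product)
      (simp add: sum_distrib_left char_mult mult_ac)
  also have "\<dots> = (\<Sum>s\<in>UNIV. \<Sum>\<psi>\<in>mult_chars. \<Sum>t\<in>UNIV. f s * h t * \<psi> (e * s * t))"
    by (rule sum.swap)
  also have "\<dots> = (\<Sum>s\<in>UNIV. \<Sum>t\<in>UNIV. f s * h t * (\<Sum>\<psi>\<in>mult_chars. \<psi> (e * s * t)))"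
    unfolding sum_distrib_left by (intro sum.cong refl sum.swap)
  also have "\<dots> = (\<Sum>s\<in>UNIV. ?q1 * (f s * h (inverse (e * s))))"
  proof (rule sum.cong)
    fix s :: 'a
    show "(\<Sum>t\<in>UNIV. f s * h t * (\<Sum>\<psi>\<in>mult_chars. \<psi> (e * s * t))) =
        ?q1 * (f s * h (inverse (e * s)))"
    proof (cases "s = 0")
      case False
      then have "e * s * t = 1 \<longleftrightarrow> t = inverse (e * s)" for t
        using e by (auto simp: field_simps)
      then have "(\<Sum>t\<in>UNIV. f s * h t * (\<Sum>\<psi>\<in>mult_chars. \<psi> (e * s * t))) =
          (\<Sum>t\<in>UNIV. if t = inverse (e * s) then f s * h t * ?q1 else 0)"
        by (intro sum.cong) (auto simp: sum_over_chars)
      then show ?thesis by (simp add: mult_ac)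
    qed (simp add: f)
  qed simp
  finally show ?thesis by (simp add: sum_distrib_left)
qed

section \<open>Odd characteristic and the value of a character at -1\<close>

lemma odd_card_imp_two_neq_zero:
  assumes "odd CARD('a :: finite_field)"
  shows "(2 :: 'a) \<noteq> 0"
proof
  assume two: "(2 :: 'a) = 0"
  \<comment> \<open>Invariance of the sum of all elements under translation by 1 yields q = 0 in the
    field; with q odd and 2 = 0 this would read 1 = 0.\<close>
  have "(\<Sum>x\<in>UNIV. x :: 'a) = (\<Sum>x\<in>UNIV. x + 1)"
    by (rule sum.reindex_bij_witness[of _ "\<lambda>x. x + 1" "\<lambda>x. x - 1"]) auto
  then have "(of_nat CARD('a) :: 'a) = 0" by (simp add: sum.distrib)
  moreover obtain k where "CARD('a) = 2 * k + 1" using assms by (elim oddE)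
  ultimately show False using two by simp
qed

lemma sum_char_square_roots_one:
  fixes A :: "'a :: finite_field \<Rightarrow> complex"
  assumes "A \<in> mult_chars" "odd CARD('a)"
  shows "(\<Sum>R\<in>{R \<in> mult_chars. R\<^sup>2 = A}. R 1) = 1 + A (-1)"
proof -
  have "{s :: 'a. s\<^sup>2 = 1} = {1, -1}" by (auto simp: power2_eq_1_iff)
  moreover have "(1 :: 'a) \<noteq> -1"
    using odd_card_imp_two_neq_zero[OF assms(2)] by (simp add: eq_neg_iff_add_eq_0)
  ultimately show ?thesis
    unfolding sum_char_square_roots[OF assms(1)] using assms by (simp add: char_1)
qed

text \<open>Without square roots the sum over R in \<open>sum_char_square_roots\<close> is empty, so
  at t = 1 the values of A at the square roots of 1 add up to 0. If 1 = -1 this would say A(1) =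
  0.\<close>

lemma nonsquare_char_minus_one:
  fixes A :: "'a :: finite_field \<Rightarrow> complex"
  assumes A: "A \<in> mult_chars" and nonsquare: "\<nexists>S. S \<in> mult_chars \<and> A = S\<^sup>2"
  shows "A (-1) = -1"
proof -
  have "(\<Sum>R\<in>{R \<in> mult_chars. R\<^sup>2 = A}. R 1) = 0"
    using nonsquare by (intro sum.neutral) auto
  then have "(\<Sum>s\<in>{s :: 'a. s\<^sup>2 = 1}. A s) = 0"
    using A by (simp add: sum_char_square_roots)
  moreover have "{s :: 'a. s\<^sup>2 = 1} = {1, -1}" by (auto simp: power2_eq_1_iff)
  ultimately have "(\<Sum>s\<in>{1, -1}. A s) = 0" by simp
  then show ?thesis
    using A by (cases "(1 :: 'a) = -1") (auto simp: char_1 add_eq_0_iff)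
qed

section \<open>Gauss sums\<close>

text \<open>The Fourier transform of \<open>U\<close>. It equals
  \<open>inverse (U t) * gauss_sum \<theta> U\<close> except when \<open>U\<close> is trivial and t
  = 0, where it is q - 1; keeping it as a transform isolates this exception.\<close>

definition gauss_twist ::
    "('a :: finite_field \<Rightarrow> complex) \<Rightarrow> ('a \<Rightarrow> complex) \<Rightarrow> 'a \<Rightarrow> complex" where
  "gauss_twist \<theta> U t = (\<Sum>w\<in>UNIV. U w * \<theta> (w * t))"

lemma gauss_twist_mult:
  assumes U: "U \<in> mult_chars" and u: "u \<noteq> 0"
  shows "gauss_twist \<theta> U (u * t) = inverse (U u) * gauss_twist \<theta> U t"
proof -
  have "gauss_twist \<theta> U (u * t) = (\<Sum>w\<in>UNIV. U (inverse u * w) * \<theta> (w * t))"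
    unfolding gauss_twist_def
    by (rule sum.reindex_bij_witness[of _ "\<lambda>w. inverse u * w" "\<lambda>w. u * w"])
      (use u in \<open>auto simp: mult_ac\<close>)
  also have "\<dots> = inverse (U u) * gauss_twist \<theta> U t"
    unfolding gauss_twist_def using U
    by (simp add: char_mult char_inverse sum_distrib_left mult_ac)
  finally show ?thesis .
qed

section \<open>Basic identities for Gauss sums of a fixed nontrivial additive character\<close>

context
  fixes \<theta> :: "'a :: finite_field \<Rightarrow> complex"
  fixes q :: complex
  assumes \<theta>: "nontrivial_additive_char \<theta>"
  defines "q \<equiv> of_nat CARD('a)"
begin

lemma of_nat_card [simp]: "of_nat CARD('a) = q"
  by (simp add: q_def)

abbreviation (input) g where "g \<equiv> gauss_sum \<theta>"
abbreviation (input) tw where "tw \<equiv> gauss_twist \<theta>"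

lemma q_neq_0: "q \<noteq> 0" and q_neq_1: "q - 1 \<noteq> 0"
  using card_field_gt_1[where 'a = 'a] by (auto simp: q_def simp del: of_nat_card)

lemma theta_add: "\<theta> (x + y) = \<theta> x * \<theta> y"
  using \<theta> by (simp add: nontrivial_additive_char_def additive_char_def)

lemma theta_0: "\<theta> 0 = 1"
proof -
  have "\<theta> 0 \<noteq> 0" using \<theta> by (simp add: nontrivial_additive_char_def additive_char_def)
  then show ?thesis using theta_add[of 0 0] by simp
qed

lemma sum_theta: "(\<Sum>x\<in>UNIV. \<theta> x) = 0"
proof -
  obtain y where y: "\<theta> y \<noteq> 1" using \<theta> by (auto simp: nontrivial_additive_char_def)
  have "(\<Sum>x\<in>UNIV. \<theta> x) = (\<Sum>x\<in>UNIV. \<theta> (y + x))"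
    by (rule sum.reindex_bij_witness[of _ "\<lambda>x. y + x" "\<lambda>x. x - y"]) auto
  also have "\<dots> = \<theta> y * (\<Sum>x\<in>UNIV. \<theta> x)"
    by (simp add: theta_add sum_distrib_left)
  finally show ?thesis using y by (simp add: field_simps)
qed

lemma gauss_twist_one: "tw U 1 = g U"
  by (simp add: gauss_twist_def gauss_sum_def)

lemma gauss_twist_nonzero: "U \<in> mult_chars \<Longrightarrow> t \<noteq> 0 \<Longrightarrow> tw U t = inverse (U t) * g U"
  using gauss_twist_mult[of U t \<theta> 1] by (simp add: gauss_twist_one)

lemma gauss_twist_nontriv:
  assumes "U \<in> mult_chars" "U \<noteq> triv_char"
  shows "tw U t = inverse (U t) * g U"
  using assms
  by (cases "t = 0") (simp_all add: gauss_twist_nonzero, simp add: gauss_twist_def theta_0 sum_char char_0)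

lemma gauss_sum_triv: "g triv_char = -1"
proof -
  have "g triv_char = (\<Sum>x\<in>UNIV. \<theta> x - (if x = 0 then 1 else 0))"
    unfolding gauss_sum_def by (rule sum.cong) (auto simp: triv_char_def theta_0)
  also have "\<dots> = -1" by (simp only: sum_subtractf sum_theta) simp
  finally show ?thesis .
qed

lemma gauss_twist_triv: "tw triv_char t = (if t = 0 then q else 0) - 1"
proof (cases "t = 0")
  case True
  then show ?thesis
    by (simp add: gauss_twist_def theta_0 sum_char triv_char_in_mult_chars)
qed (simp add: gauss_twist_nonzero triv_char_in_mult_chars gauss_sum_triv triv_char_def)

text \<open>Substitute x = w s in the double sum over x and w; the terms with w = 0 vanish on both
  sides since characters are 0 at 0. The inner sum over w is the twist of the product
  character.\<close>

lemma gauss_sum_mult: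
  assumes "U \<in> mult_chars" "V \<in> mult_chars"
  shows "g U * g V = (\<Sum>s\<in>UNIV. U s * tw (U * V) (1 + s))"
proof -
  have "g U * g V = (\<Sum>w\<in>UNIV. \<Sum>x\<in>UNIV. U x * \<theta> x * (V w * \<theta> w))"
    unfolding gauss_sum_def by (subst sum.swap) (simp add: sum_product)
  also have "\<dots> = (\<Sum>w\<in>UNIV. \<Sum>s\<in>UNIV. U s * ((U * V) w * \<theta> (w * (1 + s))))"
  proof (rule sum.cong)
    fix w :: 'a
    show "(\<Sum>x\<in>UNIV. U x * \<theta> x * (V w * \<theta> w)) =
        (\<Sum>s\<in>UNIV. U s * ((U * V) w * \<theta> (w * (1 + s))))"
    proof (cases "w = 0")
      case False
      have "(\<Sum>x\<in>UNIV. U x * \<theta> x * (V w * \<theta> w)) =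
          (\<Sum>s\<in>UNIV. U (w * s) * \<theta> (w * s) * (V w * \<theta> w))"
        by (rule sum.reindex_bij_witness[of _ "\<lambda>x. w * x" "\<lambda>x. x / w"]) (use False in auto)
      also have "\<dots> = (\<Sum>s\<in>UNIV. U s * ((U * V) w * \<theta> (w * (1 + s))))"
        using assms by (simp add: char_mult distrib_left theta_add mult_ac)
      finally show ?thesis .
    qed (use assms in \<open>simp add: char_0\<close>)
  qed simp
  also have "\<dots> = (\<Sum>s\<in>UNIV. U s * tw (U * V) (1 + s))"
    by (subst sum.swap) (simp add: gauss_twist_def sum_distrib_left)
  finally show ?thesis .
qed

text \<open>In \<open>gauss_sum_mult\<close> the product character is trivial, so its twist is -1
  plus a spike of height q at s = -1, and the constant part is killed by
  \<open>sum_char\<close>.\<close>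

lemma gauss_sum_inverse:
  assumes U: "U \<in> mult_chars" "U \<noteq> triv_char"
  shows "g U * g (inverse U) = U (-1) * q"
proof -
  have "g U * g (inverse U) = (\<Sum>s\<in>UNIV. (if s = -1 then U s * q else 0) - U s)"
    using U by (auto simp: gauss_sum_mult char_intros mult_inverse_char gauss_twist_triv
      eq_neg_iff_add_eq_0 add.commute algebra_simps intro!: sum.cong)
  also have "\<dots> = U (-1) * q"
    using U by (simp add: sum_subtractf sum_char)
  finally show ?thesis .
qed

lemma gauss_sum_neq_0:
  assumes "U \<in> mult_chars"
  shows "g U \<noteq> 0"
proof (cases "U = triv_char")
  case False
  then have "g U * g (inverse U) \<noteq> 0"
    using assms q_neq_0 by (simp add: gauss_sum_inverse char_eq_0_iff)
  then show ?thesis by auto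
qed (simp add: gauss_sum_triv)

text \<open>A Jacobi sum. The factor V(-1) g(V^(-1)) stands for q / g(V), which it equals for
  nontrivial V; in this form the evaluation also holds for trivial V, where the sum merely omits s =
  -1.\<close>

lemma sum_char_shifted_char:
  assumes U: "U \<in> mult_chars" and V: "V \<in> mult_chars"
    and nt: "U \<noteq> triv_char \<or> V \<noteq> triv_char"
  shows "q * (\<Sum>s\<in>UNIV. U s * inverse (V (1 + s))) =
    V (-1) * g (inverse V) * g U * g (inverse U * V)"
proof (cases "V = triv_char")
  case True
  have "U s * inverse (V (1 + s)) = U s - (if s = -1 then U s else 0)" for s
    unfolding True using U
    by (auto simp: triv_char_def eq_neg_iff_add_eq_0 add.commute)
  then have "(\<Sum>s\<in>UNIV. U s * inverse (V (1 + s))) = - U (-1)"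
    using U nt True by (simp add: sum_subtractf sum_char)
  moreover have "g U * g (inverse U) = U (-1) * q"
    using U nt True by (simp add: gauss_sum_inverse)
  ultimately show ?thesis
    using U True by (simp add: inverse_triv_char gauss_sum_triv mult_triv_char char_intros
      char_1 triv_char_def)
next
  case False
  have "g U * g (inverse U * V) = (\<Sum>s\<in>UNIV. U s * tw V (1 + s))"
    using U V by (simp add: gauss_sum_mult char_intros char_cancel)
  also have "\<dots> = g V * (\<Sum>s\<in>UNIV. U s * inverse (V (1 + s)))"
    using V False by (simp add: gauss_twist_nontriv sum_distrib_left mult_ac)
  finally have *: "g U * g (inverse U * V) = g V * (\<Sum>s\<in>UNIV. U s * inverse (V (1 + s)))" .
  have "V (-1) * g (inverse V) * g U * g (inverse U * V) =
      V (-1) * (g V * g (inverse V)) * (\<Sum>s\<in>UNIV. U s * inverse (V (1 + s)))"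
    using * by (simp add: mult_ac)
  then show ?thesis
    using V False by (simp add: gauss_sum_inverse char_minus_one_cancel mult_ac)
qed

section \<open>Summation formulas for products of Gauss sums\<close>

text \<open>In each pair g(U \<psi>) g(V \<psi>^(-1)) the product of the characters does not depend
  on \<psi>, so the pair is a Mellin transform in \<psi> and \<open>parseval_chars\<close> applies.
  Barnes' lemma uses e = 1, Kummer's summation e = -1.\<close>

lemma sum_four_gauss_sums:
  assumes "a \<in> mult_chars" "b \<in> mult_chars" "c \<in> mult_chars" "d \<in> mult_chars" "e \<noteq> 0"
  shows "(\<Sum>\<psi>\<in>mult_chars. \<psi> e *
      (g (a * \<psi>) * g (d * inverse \<psi>) * (g (b * \<psi>) * g (c * inverse \<psi>)))) =
    (q - 1) * (\<Sum>s\<in>UNIV. a s * tw (a * d) (1 + s) *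
      (b (inverse (e * s)) * tw (b * c) (1 + inverse (e * s))))"
proof -
  have pair: "g (U * \<psi>) * g (V * inverse \<psi>) = (\<Sum>s\<in>UNIV. U s * tw (U * V) (1 + s) * \<psi> s)"
    if U: "U \<in> mult_chars" and V: "V \<in> mult_chars" and \<psi>: "\<psi> \<in> mult_chars" for U V \<psi>
  proof -
    have "U * \<psi> * (V * inverse \<psi>) = U * V"
      using U V \<psi> by (intro char_eqI) (auto simp: char_intros char_eq_0_iff)
    then show ?thesis
      using U V \<psi> by (simp add: gauss_sum_mult char_intros mult_ac)
  qed
  have "(\<Sum>\<psi>\<in>mult_chars. \<psi> e *
      (g (a * \<psi>) * g (d * inverse \<psi>) * (g (b * \<psi>) * g (c * inverse \<psi>)))) =
    (\<Sum>\<psi>\<in>mult_chars. \<psi> e * ((\<Sum>s\<in>UNIV. a s * tw (a * d) (1 + s) * \<psi> s) *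
      (\<Sum>s\<in>UNIV. b s * tw (b * c) (1 + s) * \<psi> s)))"
    using assms by (intro sum.cong) (simp_all add: pair)
  also have "\<dots> = (q - 1) * (\<Sum>s\<in>UNIV. a s * tw (a * d) (1 + s) *
      (b (inverse (e * s)) * tw (b * c) (1 + inverse (e * s))))"
    using assms by (subst parseval_chars) (auto simp: char_0)
  finally show ?thesis .
qed

text \<open>The analogue of Barnes' first lemma: \<open>sum_four_gauss_sums\<close> reduces it to
  one Jacobi sum of \<open>a * c\<close> against \<open>a * b * c * d\<close>. The second
  alternative of the nontriviality condition admits a trivial product
  \<open>a * b * c * d\<close>.\<close>

lemma gauss_sum_barnes:
  assumes abcd: "a \<in> mult_chars" "b \<in> mult_chars" "c \<in> mult_chars" "d \<in> mult_chars"
    and nt: "a * b * c * d \<noteq> triv_char \<or> a * c \<noteq> triv_char \<and> a * d \<noteq> triv_char"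
  shows "q * (\<Sum>\<psi>\<in>mult_chars. g (a * \<psi>) * g (b * \<psi>) * g (c * inverse \<psi>) * g (d * inverse \<psi>)) =
    (q - 1) * ((a * b * c * d) (-1) * g (inverse (a * b * c * d)) *
      (g (a * c) * g (a * d) * g (b * c) * g (b * d)))"
proof -
  note [intro!] = char_intros and [simp] = char_intros abcd
  \<comment> \<open>Needed at s = -1, where both twists are taken at 0: one of the two characters is
    nontrivial, so its twist vanishes and matches the default \<open>inverse 0 = 0\<close>.\<close>
  have nt1: "a * d \<noteq> triv_char \<or> b * c \<noteq> triv_char"
    using nt mult_triv_char[OF triv_char_in_mult_chars] by (metis mult.assoc mult.commute)
  have summand: "a s * tw (a * d) (1 + s) * (b (inverse s) * tw (b * c) (1 + inverse s)) =
      g (a * d) * g (b * c) * ((a * c) s * inverse ((a * b * c * d) (1 + s)))" for s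
  proof (cases "s = 0")
    case False
    have "1 + inverse s = inverse s * (1 + s)" using False by (simp add: field_simps)
    then have "tw (b * c) (1 + inverse s) = (b * c) s * tw (b * c) (1 + s)"
      using False gauss_twist_mult[of "b * c" "inverse s" \<theta> "1 + s"] by (simp add: char_inverse)
    moreover have "tw (a * d) (1 + s) * tw (b * c) (1 + s) =
        g (a * d) * g (b * c) * inverse ((a * b * c * d) (1 + s))"
    proof (cases "1 + s = 0")
      case True
      show ?thesis using nt1 unfolding True
        by (auto simp: gauss_twist_nontriv char_0)
    qed (simp add: gauss_twist_nonzero)
    moreover have cancel: "inverse (b s) * (b s * z) = z" for z
      using False by (simp add: char_eq_0_iff flip: mult.assoc)
    ultimately show ?thesis
      by (simp add: char_inverse cancel mult.left_commute mult.assoc)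
  qed (simp add: char_0)
  have "(\<Sum>\<psi>\<in>mult_chars. g (a * \<psi>) * g (b * \<psi>) * g (c * inverse \<psi>) * g (d * inverse \<psi>)) =
    (\<Sum>\<psi>\<in>mult_chars. \<psi> 1 *
      (g (a * \<psi>) * g (d * inverse \<psi>) * (g (b * \<psi>) * g (c * inverse \<psi>))))"
    by (intro sum.cong) (simp_all add: char_1 mult_ac)
  also have "\<dots> = (q - 1) * (\<Sum>s\<in>UNIV. a s * tw (a * d) (1 + s) *
      (b (inverse s) * tw (b * c) (1 + inverse s)))"
    by (subst sum_four_gauss_sums) simp_all
  also have "\<dots> = (q - 1) * (g (a * d) * g (b * c) *
      (\<Sum>s\<in>UNIV. (a * c) s * inverse ((a * b * c * d) (1 + s))))"
    unfolding summand by (simp only: sum_distrib_left)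
  finally have "q * (\<Sum>\<psi>\<in>mult_chars. g (a * \<psi>) * g (b * \<psi>) * g (c * inverse \<psi>) * g (d * inverse \<psi>)) =
    (q - 1) * (g (a * d) * g (b * c)) *
      (q * (\<Sum>s\<in>UNIV. (a * c) s * inverse ((a * b * c * d) (1 + s))))"
    by (simp only: mult_ac)
  also have "q * (\<Sum>s\<in>UNIV. (a * c) s * inverse ((a * b * c * d) (1 + s))) =
      (a * b * c * d) (-1) * g (inverse (a * b * c * d)) * g (a * c) * g (b * d)"
  proof -
    have "inverse (a * c) * (a * b * c * d) = b * d"
      by (rule char_eqI) (auto simp: char_eq_0_iff field_simps)
    then show ?thesis
      using nt by (subst sum_char_shifted_char) auto
  qed
  finally show ?thesis by (simp only: mult_ac)
qed

text \<open>The analogue of Kummer's summation. For nontrivial F, the choice e = -1 produces A(s) /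
  F(1 - s^2), a function of s^2 apart from A(s), so grouping by t = s^2 turns it into Jacobi sums
  over the square roots R of A.\<close>

lemma gauss_sum_kummer:
  assumes A: "A \<in> mult_chars" "A \<noteq> triv_char" and F: "F \<in> mult_chars" and odd: "odd CARD('a)"
  shows "(\<Sum>\<chi>\<in>mult_chars. \<chi> (-1) *
      (g (A * \<chi>) * g (inverse \<chi>) * g (F * \<chi>) * g (inverse A * F * inverse \<chi>))) =
    (q - 1) * (g F * (\<Sum>R\<in>{R \<in> mult_chars. R\<^sup>2 = A}. R (-1) * g R * g (inverse R * F)))"
proof -
  note [simp] = char_intros A(1) F
  let ?roots = "{R \<in> mult_chars. R\<^sup>2 = A}"
  have two: "(2 :: 'a) \<noteq> 0" using odd by (rule odd_card_imp_two_neq_zero)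
  \<comment> \<open>Paired this way, with the trivial character inserted, both pairs have product F,
    so both twists are twists of F.\<close>
  have "(\<Sum>\<chi>\<in>mult_chars. \<chi> (-1) *
      (g (A * \<chi>) * g (inverse \<chi>) * g (F * \<chi>) * g (inverse A * F * inverse \<chi>))) =
    (\<Sum>\<chi>\<in>mult_chars. \<chi> (-1) * (g (A * \<chi>) * g (inverse A * F * inverse \<chi>) *
      (g (F * \<chi>) * g (triv_char * inverse \<chi>))))"
    by (intro sum.cong) (simp_all add: triv_char_mult mult_ac)
  also have "\<dots> = (q - 1) * (\<Sum>s\<in>UNIV. A s * tw F (1 + s) *
      (F (inverse (-1 * s)) * tw F (1 + inverse (-1 * s))))"
    by (subst sum_four_gauss_sums) (simp_all add: char_cancel mult_triv_char)
  also have "(\<Sum>s\<in>UNIV. A s * tw F (1 + s) *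
      (F (inverse (-1 * s)) * tw F (1 + inverse (-1 * s)))) =
    (\<Sum>s\<in>UNIV. F (-1) * (A s * (tw F (1 + s) * tw F (s - 1))))"
  proof (rule sum.cong)
    fix s :: 'a
    show "A s * tw F (1 + s) * (F (inverse (-1 * s)) * tw F (1 + inverse (-1 * s))) =
        F (-1) * (A s * (tw F (1 + s) * tw F (s - 1)))"
    proof (cases "s = 0")
      case False
      have "1 + inverse (-1 * s) = inverse s * (s - 1)" using False by (simp add: field_simps)
      then have "tw F (1 + inverse (-1 * s)) = F s * tw F (s - 1)"
        using False gauss_twist_mult[of F "inverse s" \<theta> "s - 1"] by (simp add: char_inverse)
      moreover have "F (inverse (-1 * s)) = F (-1) * inverse (F s)"
        by (simp add: char_inverse char_minus[of F "inverse s"])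
      moreover have "inverse (F s) * (F s * z) = z" for z
        using False by (simp add: char_eq_0_iff flip: mult.assoc)
      ultimately show ?thesis by (simp add: mult_ac)
    qed (simp add: char_0)
  qed simp
  also have "\<dots> = g F * (\<Sum>R\<in>?roots. R (-1) * g R * g (inverse R * F))"
  proof (cases "F = triv_char")
    case True
    \<comment> \<open>For trivial F each twist is -1 plus a spike of height q, at s = -1 and s = 1.
      Since q is odd these points differ and the product of the spikes drops out.\<close>
    have "F (-1) * (A s * (tw F (1 + s) * tw F (s - 1))) =
        A s - (if s = 1 then q * A s else 0) - (if s = -1 then q * A s else 0)" for s
    proof -
      have "1 + s = 0 \<longleftrightarrow> s = -1" by (auto simp: eq_neg_iff_add_eq_0 add.commute)
      moreover have "(1 :: 'a) \<noteq> -1" using two by (simp add: eq_neg_iff_add_eq_0)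
      ultimately show ?thesis
        by (auto simp: True gauss_twist_triv triv_char_def algebra_simps)
    qed
    then have "(\<Sum>s\<in>UNIV. F (-1) * (A s * (tw F (1 + s) * tw F (s - 1)))) =
        (\<Sum>s\<in>UNIV. A s - (if s = 1 then q * A s else 0) - (if s = -1 then q * A s else 0))"
      by (simp only:)
    also have "\<dots> = - q * (1 + A (-1))"
      using A by (simp add: sum_subtractf sum_char char_1) (simp add: algebra_simps)
    also have "1 + A (-1) = (\<Sum>R\<in>?roots. R 1)"
      using odd by (simp add: sum_char_square_roots_one)
    \<comment> \<open>Square roots of the nontrivial A are nontrivial, so R(-1) g(R) g(R^(-1)) = q
      for each of them.\<close>
    also have "- q * \<dots> = g F * (\<Sum>R\<in>?roots. R (-1) * (g R * g (inverse R)))"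
    proof -
      have "R (-1) * (g R * g (inverse R)) = q * R 1" if "R \<in> ?roots" for R
      proof -
        have "R \<noteq> triv_char" using that square_root_char_nontriv[OF A(2)] by simp
        then show ?thesis using that
          by (simp add: gauss_sum_inverse char_minus_one_cancel char_1)
      qed
      then show ?thesis by (simp add: True gauss_sum_triv sum_distrib_left)
    qed
    finally show ?thesis by (simp add: True mult_triv_char mult.assoc)
  next
    case False
    have "F (-1) * (A s * (tw F (1 + s) * tw F (s - 1))) =
        g F * g F * (A s * inverse (F (1 - s\<^sup>2)))" for s
    proof -
      have "1 - s\<^sup>2 = -1 * ((1 + s) * (s - 1))" by (simp add: algebra_simps power2_eq_square)
      then have "inverse (F (1 - s\<^sup>2)) = F (-1) * (inverse (F (1 + s)) * inverse (F (s - 1)))"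
        by (simp only: char_mult[OF F] inverse_mult_distrib inverse_char_minus_one[OF F])
      then show ?thesis using False by (simp add: gauss_twist_nontriv mult_ac)
    qed
    then have "(\<Sum>s\<in>UNIV. F (-1) * (A s * (tw F (1 + s) * tw F (s - 1)))) =
        g F * g F * (\<Sum>s\<in>UNIV. A s * inverse (F (1 - s\<^sup>2)))"
      by (simp only: sum_distrib_left)
    also have "(\<Sum>s\<in>UNIV. A s * inverse (F (1 - s\<^sup>2))) =
        (\<Sum>t\<in>UNIV. \<Sum>s\<in>{s \<in> UNIV. s\<^sup>2 = t}. A s * inverse (F (1 - s\<^sup>2)))"
      by (rule sum.group [symmetric]) auto
    also have "\<dots> = (\<Sum>t\<in>UNIV. (\<Sum>s\<in>{s. s\<^sup>2 = t}. A s) * inverse (F (1 - t)))"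
      by (simp add: sum_distrib_right)
    also have "\<dots> = (\<Sum>R\<in>?roots. \<Sum>t\<in>UNIV. R t * inverse (F (1 - t)))"
      by (subst sum.swap) (simp add: sum_char_square_roots flip: sum_distrib_right)
    also have "\<dots> = (\<Sum>R\<in>?roots. R (-1) * (\<Sum>t\<in>UNIV. R t * inverse (F (1 + t))))"
    proof (rule sum.cong)
      fix R assume R: "R \<in> ?roots"
      have "(\<Sum>t\<in>UNIV. R t * inverse (F (1 - t))) = (\<Sum>t\<in>UNIV. R (-1 * t) * inverse (F (1 + t)))"
        by (rule sum.reindex_bij_witness[of _ uminus uminus]) auto
      then show "(\<Sum>t\<in>UNIV. R t * inverse (F (1 - t))) =
          R (-1) * (\<Sum>t\<in>UNIV. R t * inverse (F (1 + t)))"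
        using R by (simp only: mem_Collect_eq char_mult sum_distrib_left mult_ac)
    qed simp
    also have "g F * g F * \<dots> = g F * (\<Sum>R\<in>?roots. R (-1) * g R * g (inverse R * F))"
    proof -
      have *: "g F * (\<Sum>t\<in>UNIV. R t * inverse (F (1 + t))) = g R * g (inverse R * F)"
        if "R \<in> ?roots" for R
      proof -
        have "q * (g F * (\<Sum>t\<in>UNIV. R t * inverse (F (1 + t)))) =
            g F * (q * (\<Sum>t\<in>UNIV. R t * inverse (F (1 + t))))" by (simp only: mult_ac)
        also have "\<dots> = F (-1) * (g F * g (inverse F)) * (g R * g (inverse R * F))"
          using that False by (subst sum_char_shifted_char) (auto simp: mult_ac)
        also have "\<dots> = q * (g R * g (inverse R * F))"
          using False by (simp add: gauss_sum_inverse char_minus_one_cancel mult.assoc)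
        finally show ?thesis using q_neq_0 by simp
      qed
      have "g F * (\<Sum>R\<in>?roots. R (-1) * (\<Sum>t\<in>UNIV. R t * inverse (F (1 + t)))) =
          (\<Sum>R\<in>?roots. R (-1) * g R * g (inverse R * F))"
        unfolding sum_distrib_left[of "g F"]
        by (intro sum.cong refl) (simp only: mult.left_commute[of "g F"] mult.assoc *)
      then show ?thesis by (simp add: mult.assoc)
    qed
    finally show ?thesis .
  qed
  finally show ?thesis .
qed

text \<open>Barnes' lemma read backwards, with parameters C, D, \<chi> and (A \<chi>)^(-1). The
  weight \<open>h\<close> is arbitrary so that the expansion serves both Dixon's summation and the
  final series.\<close>

lemma gauss_sum_barnes_expand:
  assumes chars: "A \<in> mult_chars" "C \<in> mult_chars" "D \<in> mult_chars" and nt: "C * D \<noteq> A"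
  shows "(q - 1) * (\<Sum>\<chi>\<in>mult_chars. h \<chi> * (g (C * \<chi>) * g (inverse A * C * inverse \<chi>) *
      (g (D * \<chi>) * g (inverse A * D * inverse \<chi>)))) =
    g (inverse A * C * D) * (\<Sum>\<psi>\<in>mult_chars. g (C * \<psi>) * g (D * \<psi>) *
      (\<Sum>\<chi>\<in>mult_chars. h \<chi> * (g (inverse \<psi> * \<chi>) * g (inverse A * inverse \<psi> * inverse \<chi>))))"
proof -
  note [simp] = char_intros chars
  define V where "V = inverse A * C * D"
  have V [simp]: "V \<in> mult_chars" by (simp add: V_def)
  have "V \<noteq> triv_char"
    using nt mult_inverse_eq_triv_char_iff[of "C * D" A] by (simp add: V_def mult_ac)
  then have VV: "V (-1) * (g V * g (inverse V)) = q"
    by (simp add: gauss_sum_inverse char_minus_one_cancel)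
  have *: "(q - 1) * (g (C * \<chi>) * g (inverse A * C * inverse \<chi>) *
      (g (D * \<chi>) * g (inverse A * D * inverse \<chi>))) =
    g V * (\<Sum>\<psi>\<in>mult_chars. g (C * \<psi>) * g (D * \<psi>) *
      (g (inverse \<psi> * \<chi>) * g (inverse A * inverse \<psi> * inverse \<chi>)))"
    if \<chi>: "\<chi> \<in> mult_chars" for \<chi>
  proof -
    \<comment> \<open>The product of the four parameters is free of \<chi>, so the extra factor in
      Barnes' lemma is a constant; multiplied by g(V) it becomes q.\<close>
    have prod: "C * D * \<chi> * (inverse A * inverse \<chi>) = V"
      using \<chi> by (intro char_eqI) (auto simp: V_def char_eq_0_iff field_simps)
    have "q * (g V * (\<Sum>\<psi>\<in>mult_chars. g (C * \<psi>) * g (D * \<psi>) *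
        (g (inverse \<psi> * \<chi>) * g (inverse A * inverse \<psi> * inverse \<chi>)))) =
      g V * (q * (\<Sum>\<psi>\<in>mult_chars. g (C * \<psi>) * g (D * \<psi>) * g (\<chi> * inverse \<psi>) *
        g (inverse A * inverse \<chi> * inverse \<psi>)))"
      by (simp only: mult_ac)
    also have "q * (\<Sum>\<psi>\<in>mult_chars. g (C * \<psi>) * g (D * \<psi>) * g (\<chi> * inverse \<psi>) *
        g (inverse A * inverse \<chi> * inverse \<psi>)) =
      (q - 1) * (V (-1) * g (inverse V) * (g (C * \<chi>) *
        g (C * (inverse A * inverse \<chi>)) * g (D * \<chi>) * g (D * (inverse A * inverse \<chi>))))"
      using \<chi> \<open>V \<noteq> triv_char\<close>
      by (intro gauss_sum_barnes[of C D \<chi> "inverse A * inverse \<chi>", unfolded prod]) simp_all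
    also have "g V * \<dots> = V (-1) * (g V * g (inverse V)) * ((q - 1) * (g (C * \<chi>) *
        g (C * (inverse A * inverse \<chi>)) * g (D * \<chi>) * g (D * (inverse A * inverse \<chi>))))"
      by (simp only: mult_ac)
    also have "\<dots> = q * ((q - 1) * (g (C * \<chi>) * g (inverse A * C * inverse \<chi>) *
      (g (D * \<chi>) * g (inverse A * D * inverse \<chi>))))"
      unfolding VV by (simp only: mult_ac)
    finally show ?thesis by (rule iffD1[OF mult_left_cancel[OF q_neq_0], OF sym])
  qed
  have "(q - 1) * (\<Sum>\<chi>\<in>mult_chars. h \<chi> * (g (C * \<chi>) * g (inverse A * C * inverse \<chi>) *
      (g (D * \<chi>) * g (inverse A * D * inverse \<chi>)))) =
    (\<Sum>\<chi>\<in>mult_chars. h \<chi> * ((q - 1) * (g (C * \<chi>) * g (inverse A * C * inverse \<chi>) *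
      (g (D * \<chi>) * g (inverse A * D * inverse \<chi>)))))"
    by (simp only: sum_distrib_left mult.left_commute)
  also have "\<dots> = (\<Sum>\<chi>\<in>mult_chars. \<Sum>\<psi>\<in>mult_chars. g V * (g (C * \<psi>) * g (D * \<psi>) *
      (h \<chi> * (g (inverse \<psi> * \<chi>) * g (inverse A * inverse \<psi> * inverse \<chi>)))))"
    by (intro sum.cong refl, subst *) (simp_all only: sum_distrib_left mult_ac)
  also have "\<dots> = g V * (\<Sum>\<psi>\<in>mult_chars. g (C * \<psi>) * g (D * \<psi>) *
      (\<Sum>\<chi>\<in>mult_chars. h \<chi> * (g (inverse \<psi> * \<chi>) * g (inverse A * inverse \<psi> * inverse \<chi>))))"
    by (subst sum.swap) (simp only: sum_distrib_left)
  finally show ?thesis by (simp only: V_def)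
qed

section \<open>Dixon's summation\<close>

lemma gauss_sum_inverse_if:
  assumes "U \<in> mult_chars"
  shows "g U * g (inverse U) = U (-1) * q - (if U = triv_char then q - 1 else 0)"
  using assms by (auto simp: gauss_sum_inverse gauss_sum_triv inverse_triv_char triv_char_def)

text \<open>Orthogonality in \<chi> leaves only s = -1, where the twist of the nontrivial A is taken
  at 0 and vanishes.\<close>

lemma sum_two_gauss_sums_eq_0:
  assumes A: "A \<in> mult_chars" "A \<noteq> triv_char"
  shows "(\<Sum>\<chi>\<in>mult_chars. \<chi> (-1) * (g (A * \<chi>) * g (inverse \<chi>))) = 0"
proof -
  have "(\<Sum>\<chi>\<in>mult_chars. \<chi> (-1) * (g (A * \<chi>) * g (inverse \<chi>))) =
      (\<Sum>\<chi>\<in>mult_chars. \<Sum>s\<in>UNIV. A s * tw A (1 + s) * \<chi> (-1 * s))"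
  proof (rule sum.cong)
    fix \<chi> :: "'a \<Rightarrow> complex" assume \<chi>: "\<chi> \<in> mult_chars"
    have "A * \<chi> * inverse \<chi> = A"
      using A \<chi> by (intro char_eqI) (auto simp: char_intros char_eq_0_iff)
    then have "g (A * \<chi>) * g (inverse \<chi>) = (\<Sum>s\<in>UNIV. A s * \<chi> s * tw A (1 + s))"
      using A \<chi> by (simp add: gauss_sum_mult char_intros)
    then show "\<chi> (-1) * (g (A * \<chi>) * g (inverse \<chi>)) =
        (\<Sum>s\<in>UNIV. A s * tw A (1 + s) * \<chi> (-1 * s))"
      by (simp only: char_mult[OF \<chi>] sum_distrib_left mult_ac)
  qed simp
  also have "\<dots> = (\<Sum>s\<in>UNIV. A s * tw A (1 + s) * (\<Sum>\<chi>\<in>mult_chars. \<chi> (-1 * s)))"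
    by (subst sum.swap) (simp only: sum_distrib_left)
  also have "\<dots> = 0"
  proof (rule sum.neutral, rule ballI)
    fix s :: 'a
    have "tw A (1 + s) = 0" if "-1 * s = 1"
    proof -
      have "s = -1" using that by (metis minus_minus mult_minus1)
      then show ?thesis using A by (simp add: gauss_twist_nontriv char_0)
    qed
    then show "A s * tw A (1 + s) * (\<Sum>\<chi>\<in>mult_chars. \<chi> (-1 * s)) = 0"
      by (auto simp: sum_over_chars)
  qed
  finally show ?thesis .
qed

text \<open>
  The case of Dixon's summation where \<open>gauss_sum_barnes_expand\<close> is not applicable: all but two
  terms collapse through \<open>g(U) g(U\<^sup>-\<^sup>1) = U(-1) q\<close>.
\<close>
lemma gauss_sum_dixon_degenerate:
  assumes A: "A \<in> mult_chars" "A \<noteq> triv_char" and B: "B \<in> mult_chars" "B\<^sup>2 \<noteq> A"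
    and E: "E \<in> mult_chars" "B * E = A" and odd: "odd CARD('a)"
  shows "q * (\<Sum>\<chi>\<in>mult_chars. \<chi> (-1) * (g (A * \<chi>) * g (inverse \<chi>)) *
      (g (B * \<chi>) * g (inverse A * B * inverse \<chi>) *
       (g (E * \<chi>) * g (inverse A * E * inverse \<chi>)))) =
    (q - 1) * ((B * E) (-1) * g (inverse A * B * E) *
      (\<Sum>R\<in>{R \<in> mult_chars. R\<^sup>2 = A}.
         g R * (g B * g E * g (inverse R * B) * g (inverse R * E)) * g (R * inverse B * inverse E)))"
proof -
  note [simp] = char_intros A(1) B(1) E(1)
  let ?roots = "{R \<in> mult_chars. R\<^sup>2 = A}"
  have neq: "B \<noteq> E" using B E by (auto simp: power2_eq_square)
  have BE: "A (-1) = B (-1) * E (-1)" using E(2) by (metis times_fun_apply)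
  have cancel: "inverse A * B = inverse E" "inverse A * E = inverse B"
    unfolding E(2)[symmetric] by (auto intro!: char_eqI simp: char_eq_0_iff field_simps)
  have triv_iff: "U * \<chi> = triv_char \<longleftrightarrow> \<chi> = inverse U" if "U \<in> mult_chars" "\<chi> \<in> mult_chars" for U \<chi>
    using that mult_inverse_eq_triv_char_iff[of \<chi> "inverse U"]
    by (simp add: inverse_inverse_char mult.commute)
  \<comment> \<open>Since B E = A, the last four Gauss sums form two pairs g(U) g(U^(-1)) with U = B
    \<chi> and U = E \<chi>. Corrections occur only at \<chi> = B^(-1) and \<chi> = E^(-1), and
    never together because B^2 \<noteq> A.\<close>
  have summand: "\<chi> (-1) * (g (A * \<chi>) * g (inverse \<chi>)) *
      (g (B * \<chi>) * g (inverse A * B * inverse \<chi>) * (g (E * \<chi>) * g (inverse A * E * inverse \<chi>))) =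
    A (-1) * q\<^sup>2 * (\<chi> (-1) * (g (A * \<chi>) * g (inverse \<chi>)))
      - (if \<chi> = inverse B then (q - 1) * q * E (-1) * (g B * g E) else 0)
      - (if \<chi> = inverse E then (q - 1) * q * B (-1) * (g B * g E) else 0)"
    if \<chi>: "\<chi> \<in> mult_chars" for \<chi>
  proof -
    note [simp] = \<chi>
    have "g (B * \<chi>) * g (inverse A * B * inverse \<chi>) * (g (E * \<chi>) * g (inverse A * E * inverse \<chi>)) =
        (g (B * \<chi>) * g (inverse (B * \<chi>))) * (g (E * \<chi>) * g (inverse (E * \<chi>)))"
      unfolding cancel inverse_char_mult by (simp only: mult_ac)
    also have "\<dots> = (B (-1) * \<chi> (-1) * q - (if \<chi> = inverse B then q - 1 else 0)) *
        (E (-1) * \<chi> (-1) * q - (if \<chi> = inverse E then q - 1 else 0))"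
      by (simp add: gauss_sum_inverse_if triv_iff)
    finally have prod: "g (B * \<chi>) * g (inverse A * B * inverse \<chi>) *
        (g (E * \<chi>) * g (inverse A * E * inverse \<chi>)) = \<dots>" .
    have sq: "\<chi> (-1) * (\<chi> (-1) * z) = z" "B (-1) * (B (-1) * z) = z" "E (-1) * (E (-1) * z) = z" for z
      by (simp_all add: char_minus_one_cancel)
    have AB: "A * inverse B = E" "A * inverse E = B"
      unfolding E(2)[symmetric] by (auto intro!: char_eqI simp: char_eq_0_iff field_simps)
    consider "\<chi> = inverse B" "\<chi> \<noteq> inverse E" | "\<chi> = inverse E" "\<chi> \<noteq> inverse B"
      | "\<chi> \<noteq> inverse B" "\<chi> \<noteq> inverse E"
      using neq by (metis inverse_inverse_char)
    then show ?thesis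
    proof cases
      case 1
      then show ?thesis unfolding prod
        by (simp add: AB inverse_inverse_char inverse_char_minus_one BE power2_eq_square
          right_diff_distrib left_diff_distrib mult_ac sq char_minus_one_mult_self)
    next
      case 2
      then show ?thesis unfolding prod
        by (simp add: AB inverse_inverse_char inverse_char_minus_one BE power2_eq_square
          right_diff_distrib left_diff_distrib mult_ac sq char_minus_one_mult_self)
    next
      case 3
      then show ?thesis unfolding prod
        by (simp add: BE power2_eq_square mult_ac sq)
    qed
  qed
  have "(\<Sum>\<chi>\<in>mult_chars. \<chi> (-1) * (g (A * \<chi>) * g (inverse \<chi>)) *
      (g (B * \<chi>) * g (inverse A * B * inverse \<chi>) *
       (g (E * \<chi>) * g (inverse A * E * inverse \<chi>)))) =
    A (-1) * q\<^sup>2 * (\<Sum>\<chi>\<in>mult_chars. \<chi> (-1) * (g (A * \<chi>) * g (inverse \<chi>)))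
      - (\<Sum>\<chi>\<in>mult_chars. if \<chi> = inverse B then (q - 1) * q * E (-1) * (g B * g E) else 0)
      - (\<Sum>\<chi>\<in>mult_chars. if \<chi> = inverse E then (q - 1) * q * B (-1) * (g B * g E) else 0)"
    by (simp only: summand sum_subtractf sum_distrib_left cong: sum.cong)
  \<comment> \<open>The main term is zero by \<open>sum_two_gauss_sums_eq_0\<close>; the two
    exceptional characters remain.\<close>
  also have "\<dots> = - ((q - 1) * q * (g B * g E) * (E (-1) + B (-1)))"
    using A by (simp add: sum_two_gauss_sums_eq_0 finite_mult_chars) (simp add: algebra_simps)
  finally have lhs: "(\<Sum>\<chi>\<in>mult_chars. \<chi> (-1) * (g (A * \<chi>) * g (inverse \<chi>)) *
      (g (B * \<chi>) * g (inverse A * B * inverse \<chi>) *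
       (g (E * \<chi>) * g (inverse A * E * inverse \<chi>)))) =
    - ((q - 1) * q * (g B * g E) * (E (-1) + B (-1)))" .
  \<comment> \<open>With R^2 = B E, both R, R B^(-1) E^(-1) and R^(-1) B, R^(-1) E are pairs of
    mutually inverse characters; they are nontrivial because A is nontrivial and B^2 \<noteq>
    A.\<close>
  have "g R * (g B * g E * g (inverse R * B) * g (inverse R * E)) * g (R * inverse B * inverse E) =
      g B * g E * B (-1) * q\<^sup>2 * R 1" if "R \<in> ?roots" for R
  proof -
    have R [simp]: "R \<in> mult_chars" and RA: "R * R = B * E"
      using that E(2) by (auto simp: power2_eq_square)
    have RA': "R x * R x = B x * E x" for x using RA by (metis times_fun_apply)
    have "R \<noteq> triv_char" using that square_root_char_nontriv[OF A(2)] by simp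
    moreover have "inverse R * B \<noteq> triv_char"
      using that B mult_inverse_eq_triv_char_iff[of B R] by (auto simp: mult.commute)
    moreover have "R * inverse B * inverse E = inverse R"
    proof (rule char_eqI)
      fix x :: 'a assume "x \<noteq> 0"
      then have "R x \<noteq> 0" "B x \<noteq> 0" "E x \<noteq> 0" by (simp_all add: char_eq_0_iff)
      then show "(R * inverse B * inverse E) x = inverse R x"
        using RA'[of x] by (simp add: field_simps)
    qed simp_all
    moreover have "inverse R * E = inverse (inverse R * B)"
    proof (rule char_eqI)
      fix x :: 'a assume "x \<noteq> 0"
      then have "R x \<noteq> 0" "B x \<noteq> 0" "E x \<noteq> 0" by (simp_all add: char_eq_0_iff)
      then show "(inverse R * E) x = inverse (inverse R * B) x"
        using RA'[of x] by (simp add: field_simps)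
    qed simp_all
    ultimately have gR: "g R * g (R * inverse B * inverse E) = R (-1) * q"
      and gRB: "g (inverse R * B) * g (inverse R * E) = R (-1) * B (-1) * q"
      by (simp_all add: gauss_sum_inverse inverse_char_minus_one)
    have "g R * (g B * g E * g (inverse R * B) * g (inverse R * E)) *
        g (R * inverse B * inverse E) = (g R * g (R * inverse B * inverse E)) *
        (g (inverse R * B) * g (inverse R * E)) * (g B * g E)"
      by (simp only: mult_ac)
    also have "\<dots> = R (-1) * q * (R (-1) * B (-1) * q) * (g B * g E)"
      by (simp only: gR gRB)
    also have "\<dots> = g B * g E * B (-1) * q\<^sup>2 * R 1"
      by (simp add: char_1 char_minus_one_cancel char_minus_one_mult_self power2_eq_square mult_ac)
    finally show ?thesis .
  qed
  then have "(\<Sum>R\<in>?roots.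
      g R * (g B * g E * g (inverse R * B) * g (inverse R * E)) * g (R * inverse B * inverse E)) =
    g B * g E * B (-1) * q\<^sup>2 * (\<Sum>R\<in>?roots. R 1)"
    unfolding sum_distrib_left by (intro sum.cong) simp_all
  also have "(\<Sum>R\<in>?roots. R 1) = 1 + B (-1) * E (-1)"
    using odd BE by (simp add: sum_char_square_roots_one)
  finally have rhs: "(\<Sum>R\<in>?roots.
      g R * (g B * g E * g (inverse R * B) * g (inverse R * E)) * g (R * inverse B * inverse E)) =
    g B * g E * B (-1) * q\<^sup>2 * (1 + B (-1) * E (-1))" .
  have "g (inverse A * B * E) = -1"
    by (simp add: cancel mult_inverse_char mult.commute[of "inverse E"] gauss_sum_triv)
  then show ?thesis
    unfolding lhs rhs
    by (simp add: distrib_left mult_ac char_minus_one_cancel char_minus_one_mult_self power2_eq_square)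
      (simp add: algebra_simps)
qed

text \<open>For B E \<noteq> A, expand the B and E pairs by \<open>gauss_sum_barnes_expand\<close>.
  The sum over \<chi> is then Kummer's with F = \<psi>^(-1), and for each R the remaining sum over
  \<psi> is again of Barnes type.\<close>

lemma gauss_sum_dixon:
  assumes A: "A \<in> mult_chars" "A \<noteq> triv_char"
    and B: "B \<in> mult_chars" "B \<noteq> triv_char" "B\<^sup>2 \<noteq> A"
    and E: "E \<in> mult_chars" and odd: "odd CARD('a)"
  shows "q * (\<Sum>\<chi>\<in>mult_chars. \<chi> (-1) * (g (A * \<chi>) * g (inverse \<chi>)) *
      (g (B * \<chi>) * g (inverse A * B * inverse \<chi>) *
       (g (E * \<chi>) * g (inverse A * E * inverse \<chi>)))) =
    (q - 1) * ((B * E) (-1) * g (inverse A * B * E) *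
      (\<Sum>R\<in>{R \<in> mult_chars. R\<^sup>2 = A}.
         g R * (g B * g E * g (inverse R * B) * g (inverse R * E)) * g (R * inverse B * inverse E)))"
    (is "q * ?S = _")
proof (cases "B * E = A")
  case True
  then show ?thesis using gauss_sum_dixon_degenerate assms by blast
next
  case False
  note [simp] = char_intros A(1) B(1) E
  let ?roots = "{R \<in> mult_chars. R\<^sup>2 = A}"
  have "(q - 1) * ?S = g (inverse A * B * E) * (\<Sum>\<psi>\<in>mult_chars. g (B * \<psi>) * g (E * \<psi>) *
      (\<Sum>\<chi>\<in>mult_chars. \<chi> (-1) * (g (A * \<chi>) * g (inverse \<chi>)) *
        (g (inverse \<psi> * \<chi>) * g (inverse A * inverse \<psi> * inverse \<chi>))))"
    using False by (intro gauss_sum_barnes_expand) simp_all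
  also have "\<dots> = g (inverse A * B * E) * (\<Sum>\<psi>\<in>mult_chars. g (B * \<psi>) * g (E * \<psi>) *
      ((q - 1) * (g (inverse \<psi>) *
        (\<Sum>R\<in>?roots. R (-1) * g R * g (inverse R * inverse \<psi>)))))"
  proof -
    have "(\<Sum>\<chi>\<in>mult_chars. \<chi> (-1) * (g (A * \<chi>) * g (inverse \<chi>)) *
        (g (inverse \<psi> * \<chi>) * g (inverse A * inverse \<psi> * inverse \<chi>))) =
      (q - 1) * (g (inverse \<psi>) * (\<Sum>R\<in>?roots. R (-1) * g R * g (inverse R * inverse \<psi>)))"
      if "\<psi> \<in> mult_chars" for \<psi>
      using gauss_sum_kummer[OF A inverse_in_mult_chars[OF that] odd] by (simp only: mult.assoc)
    then show ?thesis by simp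
  qed
  also have "\<dots> = (q - 1) * (g (inverse A * B * E) *
      (\<Sum>\<psi>\<in>mult_chars. \<Sum>R\<in>?roots. R (-1) * g R *
        (g (B * \<psi>) * g (E * \<psi>) * g (triv_char * inverse \<psi>) * g (inverse R * inverse \<psi>))))"
    by (simp add: sum_distrib_left mult_ac triv_char_mult)
  also have "\<dots> = (q - 1) * (g (inverse A * B * E) * (\<Sum>R\<in>?roots. R (-1) * g R *
      (\<Sum>\<psi>\<in>mult_chars.
        g (B * \<psi>) * g (E * \<psi>) * g (triv_char * inverse \<psi>) * g (inverse R * inverse \<psi>))))"
    by (subst sum.swap) (simp only: sum_distrib_left)
  finally have "?S = g (inverse A * B * E) * (\<Sum>R\<in>?roots. R (-1) * g R *
      (\<Sum>\<psi>\<in>mult_chars.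
        g (B * \<psi>) * g (E * \<psi>) * g (triv_char * inverse \<psi>) * g (inverse R * inverse \<psi>)))"
    using q_neq_1 by simp
  then have "q * ?S = g (inverse A * B * E) * (\<Sum>R\<in>?roots. R (-1) * g R *
      (q * (\<Sum>\<psi>\<in>mult_chars.
        g (B * \<psi>) * g (E * \<psi>) * g (triv_char * inverse \<psi>) * g (inverse R * inverse \<psi>))))"
    by (simp only: sum_distrib_left mult_ac)
  also have "\<dots> = g (inverse A * B * E) * (\<Sum>R\<in>?roots. (q - 1) * ((B * E) (-1) *
      (g R * (g B * g E * g (inverse R * B) * g (inverse R * E)) * g (R * inverse B * inverse E))))"
  proof -
    have inner: "R (-1) * g R * (q * (\<Sum>\<psi>\<in>mult_chars.
        g (B * \<psi>) * g (E * \<psi>) * g (triv_char * inverse \<psi>) * g (inverse R * inverse \<psi>))) =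
      (q - 1) * ((B * E) (-1) *
      (g R * (g B * g E * g (inverse R * B) * g (inverse R * E)) * g (R * inverse B * inverse E)))"
      if "R \<in> ?roots" for R
    proof -
      have R [simp]: "R \<in> mult_chars" using that by simp
      \<comment> \<open>The product of the Barnes parameters, B E R^(-1), may be trivial; Barnes'
        lemma still applies because B and B R^(-1) are nontrivial.\<close>
      have "B * inverse R \<noteq> triv_char"
        using that B mult_inverse_eq_triv_char_iff[of B R] by auto
      then have "q * (\<Sum>\<psi>\<in>mult_chars.
          g (B * \<psi>) * g (E * \<psi>) * g (triv_char * inverse \<psi>) * g (inverse R * inverse \<psi>)) =
        (q - 1) * (B (-1) * E (-1) * R (-1) * g (inverse B * inverse E * R) *
          (g B * g (B * inverse R) * g E * g (E * inverse R)))"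
        using B by (subst gauss_sum_barnes)
          (simp_all add: mult_triv_char inverse_char_mult inverse_inverse_char inverse_char_minus_one)
      then show ?thesis by (simp add: mult_ac char_minus_one_cancel)
    qed
    show ?thesis
      by (intro arg_cong[where f = "\<lambda>z. g (inverse A * B * E) * z"] sum.cong refl inner)
  qed
  also have "\<dots> = (q - 1) * ((B * E) (-1) * g (inverse A * B * E) *
      (\<Sum>R\<in>?roots.
         g R * (g B * g E * g (inverse R * B) * g (inverse R * E)) * g (R * inverse B * inverse E)))"
    by (simp only: sum_distrib_left mult_ac)
  finally show ?thesis .
qed

section \<open>The well-poised series at minus one\<close>

text \<open>Expand the C and D pairs by \<open>gauss_sum_barnes_expand\<close>, evaluate the sum
  over \<chi> by Dixon's summation with E = \<psi>^(-1), and exchange sums: what is left over \<psi>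
  is the numerator of the 3F2 attached to R.\<close>

lemma sum_wellpoised_gauss_sums:
  assumes A: "A \<in> mult_chars" "A \<noteq> triv_char"
    and B: "B \<in> mult_chars" "B \<noteq> triv_char" "B\<^sup>2 \<noteq> A"
    and C: "C \<in> mult_chars" and D: "D \<in> mult_chars" and CD: "C * D \<noteq> A"
    and odd: "odd CARD('a)"
  shows "(\<Sum>\<chi>\<in>mult_chars. \<chi> (-1) * (g (A * \<chi>) * g (inverse \<chi>)) *
      (g (B * \<chi>) * g (inverse A * B * inverse \<chi>)) *
      (g (C * \<chi>) * g (inverse A * C * inverse \<chi>) * (g (D * \<chi>) * g (inverse A * D * inverse \<chi>)))) =
    q * g B * g (inverse A * C * D) * (\<Sum>R\<in>{R \<in> mult_chars. R\<^sup>2 = A}.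
      (\<Sum>\<chi>\<in>mult_chars. \<chi> (-1) * (g (R * inverse B * \<chi>) * g (C * \<chi>) * g (D * \<chi>) *
        g (inverse R * inverse \<chi>) * g (inverse A * B * inverse \<chi>) * g (inverse \<chi>))) /
      (g (R * inverse B) * g (inverse R)))"
    (is "?S = _ * (\<Sum>R\<in>?roots. ?T R / _)")
proof -
  note [simp] = char_intros A(1) B(1) C D
  have *: "q * (\<Sum>\<chi>\<in>mult_chars. \<chi> (-1) * (g (A * \<chi>) * g (inverse \<chi>)) *
      (g (B * \<chi>) * g (inverse A * B * inverse \<chi>)) *
      (g (inverse \<psi> * \<chi>) * g (inverse A * inverse \<psi> * inverse \<chi>))) =
    (q - 1) * (B (-1) * \<psi> (-1) * g (inverse A * B * inverse \<psi>) * (\<Sum>R\<in>?roots.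
      g R * (g B * g (inverse \<psi>) * g (inverse R * B) * g (inverse R * inverse \<psi>)) *
      g (R * inverse B * \<psi>)))" if \<psi>: "\<psi> \<in> mult_chars" for \<psi>
    using gauss_sum_dixon[OF A B inverse_in_mult_chars[OF \<psi>] odd]
    by (simp only: mult.assoc inverse_inverse_char times_fun_apply inverse_fun_apply
      inverse_char_minus_one[OF \<psi>])
  \<comment> \<open>The factor q - 1 is consumed by the Barnes expansion and q by Dixon's summation;
    both are cancelled at the end.\<close>
  have "(q - 1) * (q * ?S) = q * ((q - 1) * ?S)" by (simp only: mult_ac)
  also have "(q - 1) * ?S = g (inverse A * C * D) * (\<Sum>\<psi>\<in>mult_chars. g (C * \<psi>) * g (D * \<psi>) *
      (\<Sum>\<chi>\<in>mult_chars. \<chi> (-1) * (g (A * \<chi>) * g (inverse \<chi>)) *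
        (g (B * \<chi>) * g (inverse A * B * inverse \<chi>)) *
        (g (inverse \<psi> * \<chi>) * g (inverse A * inverse \<psi> * inverse \<chi>))))"
    using CD by (intro gauss_sum_barnes_expand) simp_all
  also have "q * \<dots> = g (inverse A * C * D) * (\<Sum>\<psi>\<in>mult_chars. g (C * \<psi>) * g (D * \<psi>) *
      (q * (\<Sum>\<chi>\<in>mult_chars. \<chi> (-1) * (g (A * \<chi>) * g (inverse \<chi>)) *
        (g (B * \<chi>) * g (inverse A * B * inverse \<chi>)) *
        (g (inverse \<psi> * \<chi>) * g (inverse A * inverse \<psi> * inverse \<chi>)))))"
    by (simp only: sum_distrib_left mult.left_commute[of q])
  also have "\<dots> = g (inverse A * C * D) * (\<Sum>\<psi>\<in>mult_chars. \<Sum>R\<in>?roots.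
      (q - 1) * (g B * (B (-1) * (g R * g (inverse R * B)) * (\<psi> (-1) *
        (g (R * inverse B * \<psi>) * g (C * \<psi>) * g (D * \<psi>) *
        g (inverse R * inverse \<psi>) * g (inverse A * B * inverse \<psi>) * g (inverse \<psi>))))))"
    by (intro arg_cong[where f = "\<lambda>z. g (inverse A * C * D) * z"] sum.cong refl, subst *)
      (assumption, simp only: sum_distrib_left mult_ac)
  also have "\<dots> = g (inverse A * C * D) * (\<Sum>R\<in>?roots.
      (q - 1) * (g B * (B (-1) * (g R * g (inverse R * B)) * ?T R)))"
    by (subst sum.swap) (simp only: sum_distrib_left)
  also have "\<dots> = (q - 1) * (q * (q * g B * g (inverse A * C * D) *
      (\<Sum>R\<in>?roots. ?T R / (g (R * inverse B) * g (inverse R)))))"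
  proof -
    \<comment> \<open>The reflection formula for R and for R B^(-1), both nontrivial, moves g(R)
      g(R^(-1) B) into the denominator, where the 3F2 normalisation expects it, at the price of
      q^2.\<close>
    have inner: "(q - 1) * (g B * (B (-1) * (g R * g (inverse R * B)) * z)) =
        (q - 1) * (q * (q * (g B * (z / (g (R * inverse B) * g (inverse R))))))"
      if "R \<in> ?roots" for R z
    proof -
      have R [simp]: "R \<in> mult_chars" using that by simp
      have "R \<noteq> triv_char" using that square_root_char_nontriv[OF A(2)] by simp
      moreover have "R * inverse B \<noteq> triv_char"
        using that B mult_inverse_eq_triv_char_iff[of R B] by auto
      ultimately have gR: "g R * g (inverse R) = R (-1) * q"
        and gRB: "g (R * inverse B) * g (inverse R * B) = R (-1) * B (-1) * q"
        using gauss_sum_inverse[of R] gauss_sum_inverse[of "R * inverse B"]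
        by (simp_all add: inverse_char_mult inverse_inverse_char inverse_char_minus_one)
      have "(B (-1) * (g R * g (inverse R * B))) * (g (R * inverse B) * g (inverse R)) =
          B (-1) * (g R * g (inverse R)) * (g (R * inverse B) * g (inverse R * B))"
        by (simp only: mult_ac)
      also have "\<dots> = q * q"
        unfolding gR gRB by (simp add: mult_ac char_minus_one_cancel char_minus_one_mult_self)
      finally have eq: "B (-1) * (g R * g (inverse R * B)) =
          q * q / (g (R * inverse B) * g (inverse R))"
        by (simp add: eq_divide_eq gauss_sum_neq_0)
      show ?thesis
        unfolding eq by (simp only: times_divide_eq_left times_divide_eq_right mult_ac)
    qed
    have "(\<Sum>R\<in>?roots. (q - 1) * (g B * (B (-1) * (g R * g (inverse R * B)) * ?T R))) =
        (\<Sum>R\<in>?roots. (q - 1) * (q * (q * (g B * (?T R / (g (R * inverse B) * g (inverse R)))))))"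
      by (intro sum.cong refl inner)
    also have "\<dots> = (q - 1) * (q * (q * (g B *
        (\<Sum>R\<in>?roots. ?T R / (g (R * inverse B) * g (inverse R))))))"
      by (simp only: sum_distrib_left)
    finally show ?thesis by (simp only: mult_ac)
  qed
  finally show ?thesis
    by (simp only: mult_left_cancel[OF q_neq_0] mult_left_cancel[OF q_neq_1])
qed

section \<open>From the hypergeometric series to sums of products of Gauss sums\<close>

lemma hyp_star_4F3:
  assumes "A \<in> mult_chars" "B \<in> mult_chars" "C \<in> mult_chars" "D \<in> mult_chars"
  shows "hyp_star \<theta> [A, B, C, D] [A * inverse B, A * inverse C, A * inverse D] (-1) =
    (\<Sum>\<chi>\<in>mult_chars. \<chi> (-1) * (g (A * \<chi>) * g (inverse \<chi>)) *
      (g (B * \<chi>) * g (inverse A * B * inverse \<chi>)) *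
      (g (C * \<chi>) * g (inverse A * C * inverse \<chi>) * (g (D * \<chi>) * g (inverse A * D * inverse \<chi>)))) /
    ((q - 1) * (g A * g B * g C * g D * g (inverse A * B) * g (inverse A * C) * g (inverse A * D)))"
  \<comment> \<open>The sign is \<chi>(-1)^4 from the definition times \<chi>(-1) from the argument,
    hence \<chi>(-1).\<close>
  using assms by (simp add: hyp_star_def inverse_char_mult inverse_inverse_char
    sum_divide_distrib mult_ac char_minus_one_cancel char_1)

lemma hyp_star_3F2:
  assumes "A \<in> mult_chars" "B \<in> mult_chars" "C \<in> mult_chars" "D \<in> mult_chars" "R \<in> mult_chars"
  shows "hyp_star \<theta> [R * inverse B, C, D] [R, A * inverse B] 1 =
    (\<Sum>\<chi>\<in>mult_chars. \<chi> (-1) * (g (R * inverse B * \<chi>) * g (C * \<chi>) * g (D * \<chi>) *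
        g (inverse R * inverse \<chi>) * g (inverse A * B * inverse \<chi>) * g (inverse \<chi>))) /
    ((q - 1) * (g (R * inverse B) * g C * g D * g (inverse R) * g (inverse A * B)))"
  \<comment> \<open>Here the argument is 1 and the sign \<chi>(-1)^3 = \<chi>(-1) comes from the
    definition alone.\<close>
  using assms by (simp add: hyp_star_def inverse_char_mult inverse_inverse_char
    sum_divide_distrib mult_ac char_minus_one_cancel char_1)

text \<open>The involution \<chi> to (A \<chi>)^(-1) swaps the two Gauss sums in each of the four
  pairs and changes the sign factor \<chi>(-1) by A(-1).\<close>

lemma sum_wellpoised_gauss_sums_reflect:
  assumes A: "A \<in> mult_chars" and B: "B \<in> mult_chars" and C: "C \<in> mult_chars" and D: "D \<in> mult_chars"
  shows "(\<Sum>\<chi>\<in>mult_chars. \<chi> (-1) * (g (A * \<chi>) * g (inverse \<chi>)) *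
      (g (B * \<chi>) * g (inverse A * B * inverse \<chi>)) *
      (g (C * \<chi>) * g (inverse A * C * inverse \<chi>) * (g (D * \<chi>) * g (inverse A * D * inverse \<chi>)))) =
    A (-1) * (\<Sum>\<chi>\<in>mult_chars. \<chi> (-1) * (g (A * \<chi>) * g (inverse \<chi>)) *
      (g (B * \<chi>) * g (inverse A * B * inverse \<chi>)) *
      (g (C * \<chi>) * g (inverse A * C * inverse \<chi>) * (g (D * \<chi>) * g (inverse A * D * inverse \<chi>))))"
    (is "sum ?f _ = _")
proof -
  have invol: "inverse (A * inverse (A * \<chi>)) = \<chi>" if "\<chi> \<in> mult_chars" for \<chi>
    using A that by (simp add: inverse_char_mult inverse_inverse_char char_cancel)
  have "sum ?f mult_chars = (\<Sum>\<chi>\<in>mult_chars. ?f (inverse (A * \<chi>)))"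
    by (rule sum.reindex_bij_witness[of _ "\<lambda>\<chi>. inverse (A * \<chi>)" "\<lambda>\<chi>. inverse (A * \<chi>)"])
      (use A in \<open>simp_all add: char_intros invol\<close>)
  also have "\<dots> = (\<Sum>\<chi>\<in>mult_chars. A (-1) * ?f \<chi>)"
  proof (rule sum.cong)
    fix \<chi> :: "'a \<Rightarrow> complex" assume \<chi>: "\<chi> \<in> mult_chars"
    have r1: "A * inverse (A * \<chi>) = inverse \<chi>"
      using A \<chi> by (simp add: inverse_char_mult char_cancel char_intros)
    have r2: "U * inverse (A * \<chi>) = inverse A * U * inverse \<chi>" for U
      by (simp add: inverse_char_mult mult_ac)
    have r3: "inverse A * U * (A * \<chi>) = U * \<chi>" if "U \<in> mult_chars" for U
      using A \<chi> that by (intro char_eqI) (auto simp: char_intros char_eq_0_iff)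
    have r4: "inverse (A * \<chi>) (-1) = A (-1) * \<chi> (-1)"
      using A \<chi> by (simp add: inverse_char_minus_one)
    show "?f (inverse (A * \<chi>)) = A (-1) * ?f \<chi>"
      unfolding inverse_inverse_char r1 r2[of B] r2[of C] r2[of D] r3[OF B] r3[OF C] r3[OF D] r4
      by (simp only: mult_ac)
  qed simp
  finally show ?thesis unfolding sum_distrib_left .
qed

lemma hyp_star_wellpoised_eq_0:
  assumes "A \<in> mult_chars" "B \<in> mult_chars" "C \<in> mult_chars" "D \<in> mult_chars"
    and "\<nexists>S. S \<in> mult_chars \<and> A = S\<^sup>2"
  shows "hyp_star \<theta> [A, B, C, D] [A * inverse B, A * inverse C, A * inverse D] (-1) = 0"
proof -
  have "A (-1) = -1" using nonsquare_char_minus_one assms by blast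
  then show ?thesis
    using sum_wellpoised_gauss_sums_reflect[OF assms(1-4)]
    unfolding hyp_star_4F3[OF assms(1-4)] by simp
qed

lemma hyp_star_wellpoised_eq:
  assumes A: "A \<in> mult_chars" "A \<noteq> triv_char" and square: "\<exists>S. S \<in> mult_chars \<and> A = S\<^sup>2"
    and B: "B \<in> mult_chars" "B \<noteq> triv_char" "B\<^sup>2 \<noteq> A"
    and C: "C \<in> mult_chars" and D: "D \<in> mult_chars" and CD: "C * D \<noteq> A"
    and odd: "odd CARD('a)"
  shows "hyp_star \<theta> [A, B, C, D] [A * inverse B, A * inverse C, A * inverse D] (-1) =
    g (inverse A) * g (inverse A * C * D) / (g (inverse A * C) * g (inverse A * D)) *
    (\<Sum>R\<in>{R \<in> mult_chars. R\<^sup>2 = A}. hyp_star \<theta> [R * inverse B, C, D] [R, A * inverse B] 1)"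
proof -
  let ?roots = "{R \<in> mult_chars. R\<^sup>2 = A}"
  define T where "T R = (\<Sum>\<chi>\<in>mult_chars. \<chi> (-1) * (g (R * inverse B * \<chi>) * g (C * \<chi>) * g (D * \<chi>) *
        g (inverse R * inverse \<chi>) * g (inverse A * B * inverse \<chi>) * g (inverse \<chi>)))" for R
  define Z where "Z = (\<Sum>R\<in>?roots. T R / (g (R * inverse B) * g (inverse R)))"
  \<comment> \<open>For a square A the reflection formula has no sign, so q = g(A) g(A^(-1)): the
    first factor cancels the normalisation of the 4F3 and the second appears in the
    prefactor.\<close>
  have "A (-1) = 1"
    using square char_minus_one_mult_self by (auto simp: power2_eq_square)
  then have q: "q = g A * g (inverse A)"
    using A by (simp add: gauss_sum_inverse)
  have nz: "g A \<noteq> 0" "g B \<noteq> 0" "g C \<noteq> 0" "g D \<noteq> 0"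
    using A B C D by (simp_all add: gauss_sum_neq_0)
  have "(\<Sum>R\<in>?roots. hyp_star \<theta> [R * inverse B, C, D] [R, A * inverse B] 1) =
      (\<Sum>R\<in>?roots. T R / (g (R * inverse B) * g (inverse R)) /
        ((q - 1) * (g C * g D * g (inverse A * B))))"
    using A B C D by (intro sum.cong) (simp_all add: hyp_star_3F2 T_def mult_ac)
  also have "\<dots> = Z / ((q - 1) * (g C * g D * g (inverse A * B)))"
    by (simp only: Z_def sum_divide_distrib)
  finally have rhs: "(\<Sum>R\<in>?roots. hyp_star \<theta> [R * inverse B, C, D] [R, A * inverse B] 1) = \<dots>" .
  have "hyp_star \<theta> [A, B, C, D] [A * inverse B, A * inverse C, A * inverse D] (-1) =
      q * g B * g (inverse A * C * D) * Z /
      ((q - 1) * (g A * g B * g C * g D * g (inverse A * B) * g (inverse A * C) * g (inverse A * D)))"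
    unfolding hyp_star_4F3[OF A(1) B(1) C D] sum_wellpoised_gauss_sums[OF A B C D CD odd]
    by (simp only: Z_def T_def)
  also have "\<dots> = g A * g B * (g (inverse A) * g (inverse A * C * D) * Z) /
      (g A * g B * ((q - 1) * (g C * g D * g (inverse A * B) * g (inverse A * C) * g (inverse A * D))))"
    by (subst (1) q) (simp only: mult_ac)
  also have "\<dots> = g (inverse A) * g (inverse A * C * D) * Z /
      ((q - 1) * (g C * g D * g (inverse A * B) * g (inverse A * C) * g (inverse A * D)))"
    using nz by simp
  also have "\<dots> = g (inverse A) * g (inverse A * C * D) / (g (inverse A * C) * g (inverse A * D)) *
      (\<Sum>R\<in>?roots. hyp_star \<theta> [R * inverse B, C, D] [R, A * inverse B] 1)"
    unfolding rhs by (simp add: mult_ac)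
  finally show ?thesis .
qed

end

theorem theorem1p5:
  fixes \<theta> A B C D :: "'a :: finite_field \<Rightarrow> complex"
  assumes "nontrivial_additive_char \<theta>"
    and "A \<in> mult_chars" and "B \<in> mult_chars" and "C \<in> mult_chars" and "D \<in> mult_chars"
  shows "((\<nexists>S. S \<in> mult_chars \<and> A = S\<^sup>2) \<longrightarrow>
           hyp_star \<theta> [A, B, C, D] [A * inverse B, A * inverse C, A * inverse D] (-1) = 0) \<and>
         (odd CARD('a) \<and> (\<exists>S. S \<in> mult_chars \<and> A = S\<^sup>2) \<and>
           A \<noteq> triv_char \<and> B \<noteq> triv_char \<and> B\<^sup>2 \<noteq> A \<and> C * D \<noteq> A \<longrightarrow>
           hyp_star \<theta> [A, B, C, D] [A * inverse B, A * inverse C, A * inverse D] (-1) =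
             gauss_sum \<theta> (inverse A) * gauss_sum \<theta> (inverse A * C * D) /
             (gauss_sum \<theta> (inverse A * C) * gauss_sum \<theta> (inverse A * D)) *
             (\<Sum>R\<in>{R \<in> mult_chars. R\<^sup>2 = A}.
                hyp_star \<theta> [R * inverse B, C, D] [R, A * inverse B] 1))"
  using hyp_star_wellpoised_eq_0[OF assms] hyp_star_wellpoised_eq[OF assms(1)] assms(2-5)
  by blast

end
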